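(* Let $R\in\mathcal{C}$ and let $\rho:G\to\mathrm{GL}_2(R)$ be a lift of $\overline{\rho}$. The following statements are equivalent: (i) $\rho$ is dihedral in the sense that there is a character $\chi:H\to R^\times$ lifting $\overline{\chi}$ such that $\rho$ is equivalent to $\mathrm{Ind}_H^G(\chi)_R$; (ii) the action of $\overline{H}^{\mathrm{ad}}$ on $\Gamma_\rho$ is trivial (and hence $\rho(H)\cong\Gamma_\rho\times s(\overline{\rho}(H))$); (iii) the action of $\overline{H}^{\mathrm{ad}}$ on $\Gamma_\rho/\Phi(\Gamma_\rho)$ is trivial.
   Context: Let $p$ be a prime, $\mathbb{F}$ a finite field of characteristic $p$, $W(\mathbb{F})$ its ring of Witt vectors, and $\mathcal{C}$ the category of complete local Noetherian $W(\mathbb{F})$-algebras with residue field $\mathbb{F}$; for $R\in\mathcal{C}$ let $\mathfrak{m}_R$ be its maximal ideal. All representations and characters are continuous. Let $G$ be a profinite group, $H\lhd G$ an open normal subgroup of index $2$ and $\sigma\in G\setminus H$. For a topological ring $R$ and a character $\chi:H\to R^\times$, $\mathrm{Ind}_H^G(\chi)_R=\{f:G\to R\mid f(hg)=\chi(h)f(g)\ \forall h\in H, g\in G\}$ is the free rank-$2$ $R$-module with $G$-action $(\tilde g f)(g)=f(g\tilde g)$. Let $\overline{\chi}:H\to\mathbb{F}^\times$ be a character with $\overline{\chi}\neq\overline{\chi}^\sigma$, where $\overline{\chi}^\sigma(h)=\overline{\chi}(\sigma h\sigma^{-1})$, and let $\overline{\rho}=\mathrm{Ind}_H^G(\overline{\chi})_{\mathbb{F}}:G\to\mathrm{GL}_2(\mathbb{F})$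 (it is absolutely irreducible). A lift of $\overline\rho$ is a representation $\rho:G\to\mathrm{GL}_2(R)$ with $R\in\mathcal{C}$ whose reduction modulo $\mathfrak{m}_R$ is $\overline\rho$. For such $\rho$ let $\Gamma_\rho=\ker(\rho(G)\to\overline{\rho}(G))$ (reduction modulo $\mathfrak{m}_R$), a pro-$p$ group. For a pro-$p$ group $\Gamma$, $\Phi(\Gamma)$ denotes the closure of $\Gamma^p[\Gamma,\Gamma]$. Let $\mathrm{ad}(\overline\rho)$ be the action of $G$ on $M_2(\mathbb{F})$ by conjugation via $\overline\rho$, and $\overline{H}^{\mathrm{ad}}=\mathrm{ad}(\overline\rho)(H)$, a quotient of $\overline\rho(H)$. The exact sequence $1\to\Gamma_\rho\to\rho(H)\to\overline\rho(H)\to 1$ splits; fix a splitting $s:\overline\rho(H)\to\rho(H)$. Then $\overline\rho(H)$ acts on $\Gamma_\rho$ by $x\mapsto s(y)xs(y)^{-1}$; this action factors through $\overline{H}^{\mathrm{ad}}$, and induces an action of $\overline{H}^{\mathrm{ad}}$ on $\Gamma_\rho/\Phi(\Gamma_\rho)$. *)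

theory Defs
  imports
    "HOL-Analysis.Analysis"
    "HOL-Algebra.Algebra"
    "HOL-Algebra.Algebraic_Closure_Type"
    "HOL-Library.Poly_Mapping"
begin

section \<open>Witt vectors\<close>

text \<open>
  Integer polynomials in the variables \<open>X\<^sub>0, X\<^sub>1, \<dots>\<close> (indexed by \<open>Inl\<close>) and
  \<open>Y\<^sub>0, Y\<^sub>1, \<dots>\<close> (indexed by \<open>Inr\<close>).
\<close>

type_synonym witt_mpoly = "((nat + nat) \<Rightarrow>\<^sub>0 nat) \<Rightarrow>\<^sub>0 int"

definition mp_var :: "nat + nat \<Rightarrow> witt_mpoly" where
  "mp_var v = Poly_Mapping.single (Poly_Mapping.single v 1) 1"

definition mp_eval :: "(nat + nat \<Rightarrow> 'a::comm_ring_1) \<Rightarrow> witt_mpoly \<Rightarrow> 'a" where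
  "mp_eval a P = (\<Sum>m\<in>Poly_Mapping.keys P. of_int (Poly_Mapping.lookup P m) *
      (\<Prod>v\<in>Poly_Mapping.keys m. a v ^ Poly_Mapping.lookup m v))"

definition ghost :: "nat \<Rightarrow> (nat \<Rightarrow> 'a::comm_ring_1) \<Rightarrow> nat \<Rightarrow> 'a" where
  "ghost p x n = (\<Sum>i\<le>n. of_nat p ^ i * x i ^ (p ^ (n - i)))"

text \<open>
  The polynomials \<open>S\<^sub>0, S\<^sub>1, \<dots>\<close> determined by
  \<open>ghost p S n = bop (ghost p X n) (ghost p Y n)\<close> for all \<open>n\<close>, with \<open>bop\<close> addition or
  multiplication. The coefficientwise division by \<open>p ^ n\<close> is exact by Witt's
  integrality theorem.
\<close>

function witt_poly :: "nat \<Rightarrow> (witt_mpoly \<Rightarrow> witt_mpoly \<Rightarrow> witt_mpoly) \<Rightarrow> nat \<Rightarrow> witt_mpoly" where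
  "witt_poly p bop n = Poly_Mapping.map (\<lambda>c. c div int p ^ n)
     (bop (ghost p (\<lambda>i. mp_var (Inl i)) n) (ghost p (\<lambda>i. mp_var (Inr i)) n)
      - (\<Sum>i\<in>{..<n}. of_nat p ^ i * witt_poly p bop i ^ (p ^ (n - i))))"
  by pat_completeness auto
termination
  by (relation "Wellfounded.measure (\<lambda>(p, bop, n). n)") auto

declare witt_poly.simps [simp del]

definition witt_ring :: "nat \<Rightarrow> (nat \<Rightarrow> 'a::comm_ring_1) ring" where
  "witt_ring p = \<lparr>carrier = UNIV,
     monoid.mult = (\<lambda>x y n. mp_eval (case_sum x y) (witt_poly p (*) n)),
     one = (\<lambda>n. if n = 0 then 1 else 0),
     ring.zero = (\<lambda>n. 0),
     add = (\<lambda>x y n. mp_eval (case_sum x y) (witt_poly p (+) n))\<rparr>"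


section \<open>Complete local Noetherian rings\<close>

abbreviation type_ring :: "'r::comm_ring_1 ring" where
  "type_ring \<equiv> ring_of_type_algebra"

definition max_ideal :: "'r::comm_ring_1 set" where
  "max_ideal = (THE M. maximalideal M (type_ring :: 'r ring))"

definition max_ideal_pow :: "nat \<Rightarrow> 'r::comm_ring_1 set" where
  "max_ideal_pow n = max_ideal [^]\<^bsub>ideals_set (type_ring :: 'r ring)\<^esub> n"

definition adic_topology :: "'r::comm_ring_1 topology" where
  "adic_topology = topology_generated_by {{y. y - x \<in> max_ideal_pow n} | x n. True}"

text \<open>
  The two conjuncts are injectivity and surjectivity of the canonical map from the ring
  to the inverse limit of its quotients by the powers of the maximal ideal.
\<close>

definition adic_complete :: "'r::comm_ring_1 itself \<Rightarrow> bool" where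
  "adic_complete _ \<longleftrightarrow>
     (\<Inter>n. max_ideal_pow n) = {0 :: 'r} \<and>
     (\<forall>u :: nat \<Rightarrow> 'r. (\<forall>n. u (Suc n) - u n \<in> max_ideal_pow n) \<longrightarrow>
        (\<exists>l. \<forall>n. l - u n \<in> max_ideal_pow n))"

text \<open>
  The type \<open>'r\<close> with structure map \<open>\<alpha>\<close> from the Witt vectors of \<open>'f\<close> and residue map \<open>\<pi>\<close>
  is a complete local Noetherian \<open>W('f)\<close>-algebra with residue field \<open>'f\<close>. The residue map of
  \<open>W('f)\<close> is the zeroth component.
\<close>

definition coefficient_algebra ::
  "nat \<Rightarrow> ((nat \<Rightarrow> 'f::field) \<Rightarrow> 'r::comm_ring_1) \<Rightarrow> ('r \<Rightarrow> 'f) \<Rightarrow> bool" where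
  "coefficient_algebra p \<alpha> \<pi> \<longleftrightarrow>
     noetherian_ring (type_ring :: 'r ring) \<and>
     (\<exists>!M. maximalideal M (type_ring :: 'r ring)) \<and>
     adic_complete TYPE('r) \<and>
     \<alpha> \<in> ring_hom (witt_ring p) type_ring \<and>
     \<pi> \<in> ring_hom type_ring type_ring \<and>
     surj \<pi> \<and>
     a_kernel type_ring type_ring \<pi> = max_ideal \<and>
     (\<forall>w. \<pi> (\<alpha> w) = w 0)"


section \<open>Profinite groups, characters and two-dimensional representations\<close>

definition topological_group :: "('g, 'x) monoid_scheme \<Rightarrow> 'g topology \<Rightarrow> bool" where
  "topological_group G T \<longleftrightarrow>
     group G \<and> topspace T = carrier G \<and>
     continuous_map (prod_topology T T) T (\<lambda>(x, y). x \<otimes>\<^bsub>G\<^esub> y) \<and>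
     continuous_map T T (\<lambda>x. inv\<^bsub>G\<^esub> x)"

definition profinite_group :: "('g, 'x) monoid_scheme \<Rightarrow> 'g topology \<Rightarrow> bool" where
  "profinite_group G T \<longleftrightarrow>
     topological_group G T \<and> compact_space T \<and> Hausdorff_space T \<and>
     (\<forall>x\<in>topspace T. connected_component_of_set T x = {x})"

definition is_character ::
  "('g, 'x) monoid_scheme \<Rightarrow> 'g topology \<Rightarrow> 'g set \<Rightarrow> 'r::comm_ring_1 topology \<Rightarrow>
     ('g \<Rightarrow> 'r) \<Rightarrow> bool" where
  "is_character G T H \<T> chi \<longleftrightarrow>
     chi \<in> hom (G\<lparr>carrier := H\<rparr>) (units_of type_ring) \<and>
     continuous_map (subtopology T H) \<T> chi"

definition GL2 :: "('r::comm_ring_1 ^ 2 ^ 2) monoid" where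
  "GL2 = \<lparr>carrier = {A. invertible A}, monoid.mult = (**), one = mat 1\<rparr>"

definition GL2_topology :: "'r::comm_ring_1 topology \<Rightarrow> ('r ^ 2 ^ 2) topology" where
  "GL2_topology \<T> =
     pullback_topology (carrier GL2) (\<lambda>A (i, j). A $ i $ j) (product_topology (\<lambda>_. \<T>) UNIV)"

definition is_representation ::
  "('g, 'x) monoid_scheme \<Rightarrow> 'g topology \<Rightarrow> 'r::comm_ring_1 topology \<Rightarrow>
     ('g \<Rightarrow> 'r ^ 2 ^ 2) \<Rightarrow> bool" where
  "is_representation G T \<T> \<rho> \<longleftrightarrow> \<rho> \<in> hom G GL2 \<and> continuous_map T (GL2_topology \<T>) \<rho>"

definition Ind :: "('g, 'x) monoid_scheme \<Rightarrow> 'g set \<Rightarrow> ('g \<Rightarrow> 'r::comm_ring_1) \<Rightarrow> ('g \<Rightarrow> 'r) set" where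
  "Ind G H chi = {f \<in> extensional (carrier G).
     \<forall>h\<in>H. \<forall>g\<in>carrier G. f (h \<otimes>\<^bsub>G\<^esub> g) = chi h * f g}"

definition Ind_act :: "('g, 'x) monoid_scheme \<Rightarrow> 'g \<Rightarrow> ('g \<Rightarrow> 'r) \<Rightarrow> ('g \<Rightarrow> 'r)" where
  "Ind_act G k f = (\<lambda>g\<in>carrier G. f (g \<otimes>\<^bsub>G\<^esub> k))"

text \<open>
  \<open>\<phi>\<close> is an isomorphism of modules with \<open>G\<close>-action from the space of column vectors, on which
  \<open>G\<close> acts through \<open>\<rho>\<close>, to the induced module; equivalently, \<open>\<rho>\<close> is the matrix form of the
  induced module in the basis of images of the standard unit vectors.
\<close>

definition equivalent_to_Ind ::
  "('g, 'x) monoid_scheme \<Rightarrow> 'g set \<Rightarrow> ('g \<Rightarrow> 'r::comm_ring_1) \<Rightarrow> ('g \<Rightarrow> 'r ^ 2 ^ 2) \<Rightarrow> bool" where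
  "equivalent_to_Ind G H chi \<rho> \<longleftrightarrow>
     (\<exists>\<phi> :: 'r ^ 2 \<Rightarrow> 'g \<Rightarrow> 'r.
        bij_betw \<phi> UNIV (Ind G H chi) \<and>
        (\<forall>u v. \<phi> (u + v) = (\<lambda>g\<in>carrier G. \<phi> u g + \<phi> v g)) \<and>
        (\<forall>c v. \<phi> (c *s v) = (\<lambda>g\<in>carrier G. c * \<phi> v g)) \<and>
        (\<forall>k\<in>carrier G. \<forall>v. \<phi> (\<rho> k *v v) = Ind_act G k (\<phi> v)))"

definition dihedral ::
  "('g, 'x) monoid_scheme \<Rightarrow> 'g topology \<Rightarrow> 'g set \<Rightarrow> ('r::comm_ring_1 \<Rightarrow> 'f::field) \<Rightarrow>
     ('g \<Rightarrow> 'f) \<Rightarrow> ('g \<Rightarrow> 'r ^ 2 ^ 2) \<Rightarrow> bool" where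
  "dihedral G T H \<pi> chibar \<rho> \<longleftrightarrow>
     (\<exists>chi. is_character G T H adic_topology chi \<and> (\<forall>h\<in>H. \<pi> (chi h) = chibar h) \<and>
        equivalent_to_Ind G H chi \<rho>)"


section \<open>The action on the residually trivial part of the image\<close>

definition residual_kernel ::
  "('g, 'x) monoid_scheme \<Rightarrow> ('r::comm_ring_1 \<Rightarrow> 'f::field) \<Rightarrow> ('g \<Rightarrow> 'f ^ 2 ^ 2) \<Rightarrow>
     ('g \<Rightarrow> 'r ^ 2 ^ 2) \<Rightarrow> ('r ^ 2 ^ 2) set" where
  "residual_kernel G \<pi> \<rho>bar \<rho> =
     kernel (GL2\<lparr>carrier := \<rho> ` carrier G\<rparr>) (GL2\<lparr>carrier := \<rho>bar ` carrier G\<rparr>) (map_matrix \<pi>)"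

definition frattini :: "nat \<Rightarrow> ('a, 'x) monoid_scheme \<Rightarrow> 'a topology \<Rightarrow> 'a set" where
  "frattini p K T =
     T closure_of
       (generate K {x [^]\<^bsub>K\<^esub> p | x. x \<in> carrier K} <#>\<^bsub>K\<^esub> derived K (carrier K))"

definition Ad :: "'f::comm_ring_1 ^ 2 ^ 2 \<Rightarrow> 'f ^ 2 ^ 2 \<Rightarrow> 'f ^ 2 ^ 2" where
  "Ad y = (\<lambda>M. y ** M ** inv\<^bsub>GL2\<^esub> y)"

definition ad_image :: "'g set \<Rightarrow> ('g \<Rightarrow> 'f::field ^ 2 ^ 2) \<Rightarrow> ('f ^ 2 ^ 2 \<Rightarrow> 'f ^ 2 ^ 2) set" where
  "ad_image H \<rho>bar = (\<lambda>h. Ad (\<rho>bar h)) ` H"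

text \<open>
  The element \<open>a\<close> of the adjoint image acts as conjugation by \<open>s y\<close>, for a preimage \<open>y\<close> of \<open>a\<close>
  in the image of \<open>H\<close>. On the residual kernel the result does not depend on the choice of \<open>y\<close>,
  since \<open>s\<close> maps scalar matrices to scalar matrices.
\<close>

definition ad_act ::
  "'g set \<Rightarrow> ('g \<Rightarrow> 'f::field ^ 2 ^ 2) \<Rightarrow> ('f ^ 2 ^ 2 \<Rightarrow> 'r::comm_ring_1 ^ 2 ^ 2) \<Rightarrow>
     ('f ^ 2 ^ 2 \<Rightarrow> 'f ^ 2 ^ 2) \<Rightarrow> 'r ^ 2 ^ 2 \<Rightarrow> 'r ^ 2 ^ 2" where
  "ad_act H \<rho>bar s a x =
     (let y = (SOME y. y \<in> \<rho>bar ` H \<and> Ad y = a) in s y ** x ** inv\<^bsub>GL2\<^esub> (s y))"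

definition topologically_isomorphic ::
  "('a, 'x) monoid_scheme \<Rightarrow> 'a topology \<Rightarrow> ('b, 'y) monoid_scheme \<Rightarrow> 'b topology \<Rightarrow> bool" where
  "topologically_isomorphic K S L T \<longleftrightarrow> (\<exists>f \<in> iso K L. homeomorphic_map S T f)"

end

theory Submission
  imports Defs
begin

text \<open>
  Let \<open>P\<close> be the matrix over the residue field whose rows are the functionals \<open>f \<mapsto> f \<one>\<close> and
  \<open>f \<mapsto> f \<sigma>\<close> on the induced module: it diagonalizes \<open>\<rho>bar ` H\<close>. Some \<open>\<rho>bar k\<close> has distinct
  eigenvalues, so by a contraction argument in the complete ring \<open>P\<close> lifts to a matrix \<open>N\<close> that
  diagonalizes \<open>D = s (\<rho>bar k)\<close>, and everything commuting with \<open>D\<close> is diagonal in the basis \<open>N\<close>.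

  Suppose that \<open>D\<close> acts trivially on \<open>\<Gamma>\<close> modulo its Frattini subgroup. If the \<open>(i, j)\<close> entry of
  every \<open>N g N\<inverse>\<close> with \<open>g \<in> \<Gamma>\<close> lies in \<open>\<mm> k\<close>, where \<open>i \<noteq> j\<close>, then modulo \<open>\<mm> (k + 1)\<close> this
  entry is a continuous homomorphism from \<open>\<Gamma>\<close> to an abelian group with values killed by \<open>p\<close>, hence
  trivial on the Frattini subgroup. Conjugation by \<open>D\<close> therefore preserves it, but also multiplies
  it by the ratio of two eigenvalues with distinct residues; so it lies in \<open>\<mm> (k + 1)\<close>. As
  the ring is separated, \<open>N \<Gamma> N\<inverse>\<close> is diagonal. So is \<open>N (\<rho> ` H) N\<inverse>\<close>, because \<open>\<rho> ` H\<close> is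
  generated by \<open>\<Gamma>\<close> and \<open>s ` \<rho>bar ` H\<close>, which commutes with \<open>D\<close>. The first diagonal entry of
  \<open>N (\<rho> h) N\<inverse>\<close> is the character from which \<open>\<rho>\<close> is induced. Conversely, \<open>\<rho> ` H\<close> is abelian
  when \<open>\<rho>\<close> is dihedral.
\<close>

no_notation fps_nth (infixl \<open>$\<close> 75)

section \<open>Complete local rings\<close>

lemma type_ring_simps [simp]:
  "carrier (type_ring :: 'r::comm_ring_1 ring) = UNIV"
  "x \<otimes>\<^bsub>type_ring\<^esub> y = x * y"
  "x \<oplus>\<^bsub>type_ring\<^esub> y = x + y"
  "\<one>\<^bsub>type_ring\<^esub> = (1 :: 'r)"
  "\<zero>\<^bsub>type_ring\<^esub> = (0 :: 'r)"
  by (simp_all add: ring_of_type_algebra_def)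

interpretation type_ring: cring "type_ring :: 'r::comm_ring_1 ring"
  by (rule cring_from_type_algebra)

lemma type_ring_a_inv [simp]: "\<ominus>\<^bsub>type_ring\<^esub> x = - (x :: 'r::comm_ring_1)"
  by (rule type_ring.minus_equality) auto

lemma type_ring_a_minus [simp]: "x \<ominus>\<^bsub>type_ring\<^esub> y = x - (y :: 'r::comm_ring_1)"
  by (simp add: a_minus_def)

lemma type_ring_add_pow: "x [^]\<^bsub>add_monoid type_ring\<^esub> n = of_nat n * (x :: 'r::comm_ring_1)"
  for n :: nat
  by (induction n) (simp_all add: algebra_simps)

locale complete_local_ring =
  fixes \<pi> :: "'r::comm_ring_1 \<Rightarrow> 'f::field"
  assumes unique_maximalideal: "\<exists>!M. maximalideal M (type_ring :: 'r ring)"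
    and complete: "adic_complete TYPE('r)"
    and residue_hom: "\<pi> \<in> ring_hom type_ring type_ring"
    and surj_residue: "surj \<pi>"
    and kernel_residue: "a_kernel type_ring type_ring \<pi> = max_ideal"
begin

abbreviation \<mm> :: "nat \<Rightarrow> 'r set" where "\<mm> \<equiv> max_ideal_pow"

sublocale residue: ring_hom_cring type_ring type_ring \<pi>
  by unfold_locales (rule residue_hom)

lemma residue_add [simp]: "\<pi> (x + y) = \<pi> x + \<pi> y"
  using residue.hom_add[of x y] by simp

lemma residue_mult [simp]: "\<pi> (x * y) = \<pi> x * \<pi> y"
  using residue.hom_mult[of x y] by simp

lemma residue_0 [simp]: "\<pi> 0 = 0"
  using residue.hom_zero by simp

lemma residue_1 [simp]: "\<pi> 1 = 1"
  using residue.hom_one by simp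

lemma residue_minus [simp]: "\<pi> (- x) = - \<pi> x"
  using residue.hom_a_inv[of x] by simp

lemma residue_diff [simp]: "\<pi> (x - y) = \<pi> x - \<pi> y"
  using residue_add[of x "- y"] by simp

lemma residue_of_nat [simp]: "\<pi> (of_nat n) = of_nat n"
  by (induction n) simp_all

lemma residue_sum: "\<pi> (sum f A) = (\<Sum>x\<in>A. \<pi> (f x))"
  by (induction A rule: infinite_finite_induct) simp_all

lemma mem_max_ideal_iff: "x \<in> max_ideal \<longleftrightarrow> \<pi> x = 0"
  unfolding kernel_residue[symmetric] a_kernel_def kernel_def by simp

lemma ideal_max_ideal: "ideal (max_ideal :: 'r set) type_ring"
  unfolding max_ideal_def using theI'[OF unique_maximalideal] by (rule maximalideal.axioms)

lemma max_ideal_pow_0 [simp]: "\<mm> 0 = UNIV"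
  by (simp add: max_ideal_pow_def ideals_set_def nat_pow_def)

lemma max_ideal_pow_Suc: "\<mm> (Suc n) = \<mm> n \<cdot>\<^bsub>type_ring\<^esub> max_ideal"
  by (simp add: max_ideal_pow_def ideals_set_def nat_pow_def)

lemma ideal_max_ideal_pow: "ideal (\<mm> n) type_ring"
proof (induction n)
  case 0
  show ?case using type_ring.oneideal by simp
next
  case (Suc n)
  then show ?case
    unfolding max_ideal_pow_Suc by (rule type_ring.ideal_prod_is_ideal[OF _ ideal_max_ideal])
qed

lemma zero_mem_max_ideal_pow [simp]: "0 \<in> \<mm> n"
  using additive_subgroup.zero_closed[OF ideal.axioms(1)[OF ideal_max_ideal_pow[of n]]] by simp

lemma max_ideal_pow_add: "x \<in> \<mm> n \<Longrightarrow> y \<in> \<mm> n \<Longrightarrow> x + y \<in> \<mm> n"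
  using additive_subgroup.a_closed[OF ideal.axioms(1)[OF ideal_max_ideal_pow]] by fastforce

lemma max_ideal_pow_mult_left: "x \<in> \<mm> n \<Longrightarrow> r * x \<in> \<mm> n"
  using ideal.I_l_closed[OF ideal_max_ideal_pow, of x n r] by simp

lemma max_ideal_pow_mult_right: "x \<in> \<mm> n \<Longrightarrow> x * r \<in> \<mm> n"
  using max_ideal_pow_mult_left[of x n r] by (simp add: mult.commute)

lemma max_ideal_pow_minus: "x \<in> \<mm> n \<Longrightarrow> - x \<in> \<mm> n"
  using max_ideal_pow_mult_left[of x n "- 1"] by simp

lemma max_ideal_pow_diff: "x \<in> \<mm> n \<Longrightarrow> y \<in> \<mm> n \<Longrightarrow> x - y \<in> \<mm> n"
  using max_ideal_pow_add[of x n "- y"] max_ideal_pow_minus by simp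

lemma max_ideal_pow_sum: "(\<And>i. i \<in> A \<Longrightarrow> f i \<in> \<mm> n) \<Longrightarrow> sum f A \<in> \<mm> n"
  by (induction A rule: infinite_finite_induct) (simp_all add: max_ideal_pow_add)

lemma max_ideal_pow_diff_trans: "x - y \<in> \<mm> n \<Longrightarrow> y - z \<in> \<mm> n \<Longrightarrow> x - z \<in> \<mm> n"
  using max_ideal_pow_add[of "x - y" n "y - z"] by simp

lemma max_ideal_pow_unit_mult_iff:
  assumes "u dvd 1"
  shows "u * x \<in> \<mm> n \<longleftrightarrow> x \<in> \<mm> n"
proof
  obtain v where "v * u = 1" using assms by (metis dvdE mult.commute)
  then have "v * (u * x) = x" by (simp flip: mult.assoc)
  then show "u * x \<in> \<mm> n \<Longrightarrow> x \<in> \<mm> n" using max_ideal_pow_mult_left by metis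
qed (rule max_ideal_pow_mult_left)

lemma max_ideal_pow_mult_Suc: "x \<in> \<mm> n \<Longrightarrow> \<pi> y = 0 \<Longrightarrow> x * y \<in> \<mm> (Suc n)"
  using ideal_prod.prod[of x "\<mm> n" y max_ideal "type_ring :: 'r ring"]
  by (simp add: max_ideal_pow_Suc mem_max_ideal_iff)

lemma max_ideal_pow_Suc_subset: "\<mm> (Suc n) \<subseteq> \<mm> n \<inter> max_ideal"
  unfolding max_ideal_pow_Suc
  by (rule type_ring.ideal_prod_inter[OF ideal_max_ideal_pow ideal_max_ideal])

lemma max_ideal_pow_antimono: "m \<le> n \<Longrightarrow> \<mm> n \<subseteq> \<mm> m"
  using lift_Suc_antimono_le[of \<mm> m n] max_ideal_pow_Suc_subset by blast

lemma mem_max_ideal_pow_Suc_0_iff: "x \<in> \<mm> (Suc 0) \<longleftrightarrow> \<pi> x = 0"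
  using max_ideal_pow_Suc_subset[of 0] max_ideal_pow_mult_Suc[of 1 0 x]
  by (auto simp: mem_max_ideal_iff)

lemma eq_0_if_mem_all_max_ideal_pow: "(\<And>n. x \<in> \<mm> n) \<Longrightarrow> x = 0"
  using complete by (auto simp: adic_complete_def)

lemma adic_limit_exists: "(\<And>n. u (Suc n) - u n \<in> \<mm> n) \<Longrightarrow> \<exists>l. \<forall>n. l - u n \<in> \<mm> n"
  using complete by (simp add: adic_complete_def)

lemma adic_contraction_fixed_point:
  assumes contraction: "\<And>n x y. x - y \<in> \<mm> n \<Longrightarrow> F x - F y \<in> \<mm> (Suc n)"
  obtains l where "F l = l"
proof -
  define u where "u n = (F ^^ n) 0" for n
  have u_Suc: "u (Suc n) = F (u n)" for n by (simp add: u_def)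
  have "u (Suc n) - u n \<in> \<mm> n" for n
    by (induction n) (simp_all add: u_Suc contraction)
  then obtain l where l: "\<And>n. l - u n \<in> \<mm> n" using adic_limit_exists by blast
  have "F l - l \<in> \<mm> n" for n
  proof -
    have "F l - u (Suc n) \<in> \<mm> (Suc n)" unfolding u_Suc by (rule contraction[OF l])
    then have "F l - l \<in> \<mm> (Suc n)" using max_ideal_pow_diff[OF _ l[of "Suc n"]] by fastforce
    then show ?thesis using max_ideal_pow_Suc_subset by blast
  qed
  then have "F l - l = 0" by (rule eq_0_if_mem_all_max_ideal_pow)
  then show thesis using that by simp
qed

lemma is_unit_iff_residue: "x dvd 1 \<longleftrightarrow> \<pi> x \<noteq> 0"
proof
  show "x dvd 1 \<Longrightarrow> \<pi> x \<noteq> 0" by (metis dvdE mult_zero_left residue_1 residue_mult zero_neq_one)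
next
  assume "\<pi> x \<noteq> 0"
  moreover obtain z where "\<pi> z = inverse (\<pi> x)" using surj_residue by (metis surjD)
  ultimately have residue: "\<pi> (1 - x * z) = 0" by simp
  define F where "F y = 1 + (1 - x * z) * y" for y
  have "F y - F y' \<in> \<mm> (Suc n)" if "y - y' \<in> \<mm> n" for n y y'
    using max_ideal_pow_mult_Suc[OF that residue] by (simp add: F_def algebra_simps)
  then obtain y where "F y = y" by (rule adic_contraction_fixed_point)
  then have "1 = x * (z * y)" by (simp add: F_def algebra_simps)
  then show "x dvd 1" by (rule dvdI)
qed

lemma quadratic_root_in_max_ideal:
  assumes "\<pi> a = 0" and unit: "b dvd 1" and "\<pi> c = 0"
  obtains u where "\<pi> u = 0" "a * u * u + b * u + c = 0"
proof -
  obtain d where d: "b * d = 1" using unit by (metis dvdE)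
  define F where "F u = - (d * (a * u * u + c))" for u
  have "F u - F v \<in> \<mm> (Suc n)" if "u - v \<in> \<mm> n" for n u v
  proof -
    have "(u - v) * - (d * a * (u + v)) \<in> \<mm> (Suc n)"
      using that assms(1) by (intro max_ideal_pow_mult_Suc) simp_all
    then show ?thesis by (simp add: F_def algebra_simps)
  qed
  then obtain u where u: "F u = u" by (rule adic_contraction_fixed_point)
  have "b * u = - (b * d * (a * u * u + c))"
    by (subst u[symmetric]) (simp add: F_def mult.assoc)
  then have "a * u * u + b * u + c = 0" by (simp add: d)
  moreover have "\<pi> u = 0" by (subst u[symmetric]) (simp add: F_def assms)
  ultimately show thesis using that by blast
qed

end

section \<open>Matrices over commutative rings\<close>

lemma matrix_diff_ldistrib: "A ** (B - C) = A ** B - A ** C"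
  for A :: "'a::ring_1 ^ 'n ^ 'm"
  by (simp add: vec_eq_iff matrix_matrix_mult_def sum_subtractf right_diff_distrib)

lemma matrix_diff_rdistrib: "(A - B) ** C = A ** C - B ** C"
  for A :: "'a::ring_1 ^ 'n ^ 'm"
  by (simp add: vec_eq_iff matrix_matrix_mult_def sum_subtractf left_diff_distrib)

lemma matrix_mult_row: "(A ** B) $ i = A $ i v* B"
  by (simp add: vec_eq_iff matrix_matrix_mult_def vector_matrix_mult_def)

lemma smult_vector_matrix_mult: "(c *s v) v* A = c *s (v v* A)"
  for A :: "'a::comm_ring_1 ^ 'n ^ 'm"
  by (simp add: vec_eq_iff vector_matrix_mult_def sum_distrib_left mult.assoc)

lemma matrix_vector_mult_axis: "(A *v axis j 1) $ i = A $ i $ j"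
  for A :: "'a::semiring_1 ^ 'n ^ 'm"
  by (simp add: matrix_vector_mult_def axis_def if_distrib[of "(*) _"] cong: if_cong)

lemma linear_eq_matrix_vector_mult:
  fixes L :: "'a::comm_ring_1 ^ 'n \<Rightarrow> 'a ^ 'm"
  assumes add: "\<And>u v. L (u + v) = L u + L v" and scale: "\<And>c v. L (c *s v) = c *s L v"
  shows "L v = (\<chi> i j. L (axis j 1) $ i) *v v"
proof -
  have "L 0 = 0" using add[of 0 0] by simp
  have "L v = L (\<Sum>j\<in>UNIV. v $ j *s axis j 1)" by (simp add: basis_expansion)
  also have "\<dots> = (\<Sum>j\<in>UNIV. L (v $ j *s axis j 1))"
    by (rule sum_comp_morphism[of L, OF \<open>L 0 = 0\<close> add, unfolded comp_def, symmetric])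
  also have "\<dots> = (\<chi> i j. L (axis j 1) $ i) *v v"
    by (simp add: scale vec_eq_iff matrix_vector_mult_def mult.commute)
  finally show ?thesis .
qed

lemma bij_matrix_vector_mult:
  fixes A :: "'a::semiring_1 ^ 'n ^ 'm"
  assumes "invertible A"
  shows "bij ((*v) A)"
proof -
  obtain B where "A ** B = mat 1" "B ** A = mat 1"
    using assms by (auto simp: invertible_def)
  then show ?thesis
    by (intro o_bij[of "(*v) B"]) (simp_all add: fun_eq_iff matrix_vector_mul_assoc)
qed

lemma invertible_if_bij:
  fixes A :: "'a::semiring_1 ^ 'n ^ 'm"
  assumes bij: "bij ((*v) A)"
  shows "invertible A"
proof -
  define b :: "'m \<Rightarrow> 'a ^ 'n" where "b j = inv_into UNIV ((*v) A) (axis j 1)" for j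
  have b: "A *v b j = axis j 1" for j
    unfolding b_def by (rule surj_f_inv_f[OF bij_is_surj[OF bij]])
  define B :: "'a ^ 'm ^ 'n" where "B = (\<chi> i j. b j $ i)"
  have "B *v axis j 1 = b j" for j
    by (simp add: vec_eq_iff matrix_vector_mult_axis) (simp add: B_def)
  then have right_inverse: "A ** B = mat 1"
    by (metis b matrix_vector_mult_axis matrix_vector_mul_assoc matrix_vector_mul_lid vec_eq_iff)
  have "A *v (B *v (A *v v)) = A *v v" for v
    by (metis matrix_vector_mul_assoc matrix_vector_mul_lid right_inverse)
  then have "B *v (A *v v) = v" for v
    using bij by (metis bij_is_inj injD)
  then have "B ** A = mat 1"
    by (simp add: matrix_eq flip: matrix_vector_mul_assoc)
  with right_inverse show ?thesis by (auto simp: invertible_def)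
qed

definition diagonal :: "'a::zero ^ 'n ^ 'n \<Rightarrow> bool" where
  "diagonal A \<longleftrightarrow> (\<forall>i j. i \<noteq> j \<longrightarrow> A $ i $ j = 0)"

lemma diagonal_mult_nth:
  fixes A :: "'a::comm_ring_1 ^ 'n ^ 'n"
  assumes "diagonal A"
  shows "(A ** B) $ i $ j = A $ i $ i * B $ i $ j"
proof -
  have "(A ** B) $ i $ j = (\<Sum>k\<in>UNIV. A $ i $ k * B $ k $ j)"
    by (simp add: matrix_matrix_mult_def)
  also have "\<dots> = (\<Sum>k\<in>UNIV. if k = i then A $ i $ i * B $ i $ j else 0)"
    using assms by (intro sum.cong) (auto simp: diagonal_def)
  finally show ?thesis by simp
qed

lemma mult_diagonal_nth:
  fixes A :: "'a::comm_ring_1 ^ 'n ^ 'n"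
  assumes "diagonal A"
  shows "(B ** A) $ i $ j = B $ i $ j * A $ j $ j"
proof -
  have "(B ** A) $ i $ j = (\<Sum>k\<in>UNIV. B $ i $ k * A $ k $ j)"
    by (simp add: matrix_matrix_mult_def)
  also have "\<dots> = (\<Sum>k\<in>UNIV. if k = j then B $ i $ j * A $ j $ j else 0)"
    using assms by (intro sum.cong) (auto simp: diagonal_def)
  finally show ?thesis by simp
qed

lemma diagonal_mult: "diagonal A \<Longrightarrow> diagonal B \<Longrightarrow> diagonal (A ** B)"
  for A B :: "'a::comm_ring_1 ^ 'n ^ 'n"
  by (simp add: diagonal_def[of "A ** B"] diagonal_mult_nth) (simp add: diagonal_def)

lemma diagonal_commute:
  fixes A B :: "'a::comm_ring_1 ^ 'n ^ 'n"
  assumes "diagonal A" "diagonal B"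
  shows "A ** B = B ** A"
proof -
  have "(A ** B) $ i $ j = (B ** A) $ i $ j" for i j
    using assms by (cases "i = j") (simp_all add: diagonal_mult_nth diagonal_def)
  then show ?thesis by (simp add: vec_eq_iff)
qed

lemma diagonal_if_commute:
  fixes A D :: "'a::comm_ring_1 ^ 'n ^ 'n"
  assumes D: "diagonal D" and distinct: "\<And>i j. i \<noteq> j \<Longrightarrow> D $ i $ i - D $ j $ j dvd 1"
    and commute: "D ** A = A ** D"
  shows "diagonal A"
  unfolding diagonal_def
proof (intro allI impI)
  fix i j :: 'n
  assume "i \<noteq> j"
  then obtain c where c: "1 = (D $ i $ i - D $ j $ j) * c" using distinct by (meson dvdE)
  have "D $ i $ i * A $ i $ j = A $ i $ j * D $ j $ j"
    using arg_cong[OF commute, of "\<lambda>M. M $ i $ j"] D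
    by (simp add: diagonal_mult_nth mult_diagonal_nth)
  then have "(D $ i $ i - D $ j $ j) * A $ i $ j = 0" by (simp add: algebra_simps)
  then have "1 * A $ i $ j = 0" unfolding c by (simp add: algebra_simps)
  then show "A $ i $ j = 0" by simp
qed

lemma diagonal_central_iff:
  fixes A :: "'a::comm_ring_1 ^ 'n ^ 'n"
  assumes "diagonal A"
  shows "(\<forall>M. A ** M = M ** A) \<longleftrightarrow> (\<forall>i j. A $ i $ i = A $ j $ j)"
proof
  assume "\<forall>M. A ** M = M ** A"
  then have "(A ** (\<chi> i j. 1)) $ i $ j = ((\<chi> i j. 1) ** A) $ i $ j" for i j by metis
  then show "\<forall>i j. A $ i $ i = A $ j $ j"
    using assms by (simp add: diagonal_mult_nth mult_diagonal_nth)
next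
  assume "\<forall>i j. A $ i $ i = A $ j $ j"
  then have "(A ** M) $ i $ j = (M ** A) $ i $ j" for M i j
    unfolding diagonal_mult_nth[OF assms] mult_diagonal_nth[OF assms] by (metis mult.commute)
  then show "\<forall>M. A ** M = M ** A" by (simp add: vec_eq_iff)
qed

lemma matrix_eq_2:
  "A = B \<longleftrightarrow> A $ 1 $ 1 = B $ 1 $ 1 \<and> A $ 1 $ 2 = B $ 1 $ 2 \<and>
    A $ 2 $ 1 = B $ 2 $ 1 \<and> A $ 2 $ 2 = B $ 2 $ 2"
  for A B :: "'a ^ 2 ^ 2"
  by (auto simp: vec_eq_iff forall_2)

lemma matrix_mult_2: "(A ** B) $ i $ j = A $ i $ 1 * B $ 1 $ j + A $ i $ 2 * B $ 2 $ j"
  for A B :: "'a::semiring_1 ^ 2 ^ 2"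
  by (simp add: matrix_matrix_mult_def sum_2)

lemma diagonal_2: "diagonal A \<longleftrightarrow> A $ 1 $ 2 = 0 \<and> A $ 2 $ 1 = 0"
  for A :: "'a::zero ^ 2 ^ 2"
  by (auto simp: diagonal_def forall_2)

lemma invertible_if_det_unit:
  fixes A :: "'a::comm_ring_1 ^ 2 ^ 2"
  assumes "det A dvd 1"
  shows "invertible A"
proof -
  obtain c where "1 = det A * c" using assms by (rule dvdE)
  then have c: "c * (A $ 1 $ 1 * A $ 2 $ 2 - A $ 1 $ 2 * A $ 2 $ 1) = 1"
    by (simp add: det_2 mult.commute)
  define B :: "'a ^ 2 ^ 2" where
    "B = vector [vector [c * A $ 2 $ 2, - (c * A $ 1 $ 2)],
                 vector [- (c * A $ 2 $ 1), c * A $ 1 $ 1]]"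
  have "A ** B = mat 1" "B ** A = mat 1"
    unfolding matrix_eq_2 using c by (simp_all add: matrix_mult_2 B_def mat_def algebra_simps)
  then show ?thesis unfolding invertible_def by blast
qed

lemma GL2_simps [simp]:
  "carrier GL2 = {A :: 'a::comm_ring_1 ^ 2 ^ 2. invertible A}"
  "A \<otimes>\<^bsub>GL2\<^esub> B = A ** B"
  "\<one>\<^bsub>GL2\<^esub> = (mat 1 :: 'a ^ 2 ^ 2)"
  by (simp_all add: GL2_def)

lemma group_GL2: "group (GL2 :: ('a::comm_ring_1 ^ 2 ^ 2) monoid)"
proof (rule groupI)
  fix A :: "'a ^ 2 ^ 2"
  assume "A \<in> carrier GL2"
  then obtain B where "A ** B = mat 1" "B ** A = mat 1" by (auto simp: invertible_def)
  then show "\<exists>B\<in>carrier GL2. B \<otimes>\<^bsub>GL2\<^esub> A = \<one>\<^bsub>GL2\<^esub>" by (auto simp: invertible_def)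
qed (auto simp: matrix_mul_assoc invertible_mult invertible_def[of "mat 1"]
    intro: exI[of _ "mat 1"])

interpretation GL2: group GL2
  by (rule group_GL2)

context
  fixes y :: "'a::comm_ring_1 ^ 2 ^ 2"
  assumes y: "invertible y"
begin

lemma GL2_inv: "invertible (inv\<^bsub>GL2\<^esub> y)" "y ** inv\<^bsub>GL2\<^esub> y = mat 1" "inv\<^bsub>GL2\<^esub> y ** y = mat 1"
  using y GL2.inv_closed[of y] GL2.r_inv[of y] GL2.l_inv[of y] by simp_all

lemma Ad_eq_iff: "Ad y A = B \<longleftrightarrow> y ** A = B ** y"
  unfolding Ad_def by (metis GL2_inv matrix_mul_assoc matrix_mul_rid)

lemma Ad_mat_1: "Ad y (mat 1) = mat 1"
  by (simp add: Ad_eq_iff)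

lemma Ad_mult: "Ad y (A ** B) = Ad y A ** Ad y B"
  unfolding Ad_eq_iff by (metis Ad_eq_iff matrix_mul_assoc)

lemma inj_Ad: "inj (Ad y)"
  by (rule injI) (metis Ad_eq_iff GL2_inv(3) matrix_mul_assoc matrix_mul_lid)

lemma surj_Ad: "surj (Ad y)"
proof (rule surjI)
  show "Ad y (inv\<^bsub>GL2\<^esub> y ** B ** y) = B" for B
    unfolding Ad_eq_iff by (metis GL2_inv(2) matrix_mul_assoc matrix_mul_lid)
qed

lemma Ad_commute_iff: "Ad y A ** Ad y B = Ad y B ** Ad y A \<longleftrightarrow> A ** B = B ** A"
  unfolding Ad_mult[symmetric] inj_eq[OF inj_Ad] ..

end

lemma Ad_matrix_mult:
  assumes "invertible y" "invertible z"
  shows "Ad (y ** z) A = Ad y (Ad z A)"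
proof -
  have "invertible (y ** z)" using assms by (rule invertible_mult)
  moreover have "y ** (z ** A) = y ** Ad z A ** z"
    using Ad_eq_iff[OF assms(2), of A "Ad z A"] by (simp flip: matrix_mul_assoc)
  moreover have "y ** Ad z A = Ad y (Ad z A) ** y"
    using Ad_eq_iff[OF assms(1)] by blast
  ultimately show ?thesis by (simp add: Ad_eq_iff matrix_mul_assoc)
qed

lemma Ad_eq_diagonal_if_rows:
  assumes P: "invertible P" and rows: "\<And>i. P $ i v* A = d i *s P $ i"
  shows "Ad P A = (\<chi> i j. if i = j then d i else 0)"
proof -
  let ?D = "\<chi> i j. if i = j then d i else 0"
  have "diagonal ?D" by (simp add: diagonal_def)
  then have "(?D ** P) $ i $ j = d i * P $ i $ j" for i j by (simp add: diagonal_mult_nth)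
  moreover have "(P ** A) $ i $ j = d i * P $ i $ j" for i j by (simp add: matrix_mult_row rows)
  ultimately have "P ** A = ?D ** P" by (simp add: vec_eq_iff)
  then show ?thesis by (simp add: Ad_eq_iff[OF P])
qed

lemma row_if_diagonal_Ad:
  assumes P: "invertible P" and diagonal: "diagonal (Ad P A)"
  shows "P $ i v* A = Ad P A $ i $ i *s P $ i"
proof -
  have "P ** A = Ad P A ** P" using Ad_eq_iff[OF P] by blast
  then show ?thesis by (simp add: vec_eq_iff diagonal_mult_nth[OF diagonal] flip: matrix_mult_row)
qed

lemma Ad_trivial_iff:
  assumes y: "invertible y" and P: "invertible P" and diagonal: "diagonal (Ad P y)"
  shows "(\<forall>A. Ad y A = A) \<longleftrightarrow> Ad P y $ 1 $ 1 = Ad P y $ 2 $ 2"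
proof -
  have "(\<forall>A. Ad y A = A) \<longleftrightarrow> (\<forall>A. Ad P y ** Ad P A = Ad P A ** Ad P y)"
    by (simp add: Ad_eq_iff[OF y] Ad_commute_iff[OF P])
  also have "\<dots> \<longleftrightarrow> (\<forall>B. Ad P y ** B = B ** Ad P y)"
    using surj_Ad[OF P] by (metis surjD)
  also have "\<dots> \<longleftrightarrow> Ad P y $ 1 $ 1 = Ad P y $ 2 $ 2"
    unfolding diagonal_central_iff[OF diagonal] by (auto simp: forall_2)
  finally show ?thesis .
qed

lemma diagonal_entry_hom:
  fixes \<rho> :: "'g \<Rightarrow> 'r::comm_ring_1 ^ 2 ^ 2"
  assumes "group K" and \<rho>: "\<rho> \<in> hom K GL2" and N: "invertible N"
    and diagonal: "\<And>x. x \<in> carrier K \<Longrightarrow> diagonal (Ad N (\<rho> x))"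
  shows "(\<lambda>x. Ad N (\<rho> x) $ i $ i) \<in> hom K (units_of type_ring)"
proof -
  interpret group_hom K GL2 \<rho>
    using assms(1) \<rho> by (intro group_hom.intro group_hom_axioms.intro group_GL2)
  define chi where "chi x = Ad N (\<rho> x) $ i $ i" for x
  have mult: "chi (x \<otimes>\<^bsub>K\<^esub> y) = chi x * chi y" if "x \<in> carrier K" "y \<in> carrier K" for x y
    using that by (simp add: chi_def Ad_mult[OF N] diagonal_mult_nth[OF diagonal])
  have "chi \<one>\<^bsub>K\<^esub> = 1" using hom_one by (simp add: chi_def Ad_mat_1[OF N]) (simp add: mat_def)
  then have "chi x * chi (inv\<^bsub>K\<^esub> x) = 1" if "x \<in> carrier K" for x
    using that by (simp flip: mult)
  then have "chi x \<in> Units type_ring" if "x \<in> carrier K" for x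
    using that by (simp add: Units_def) (metis mult.commute)
  then show ?thesis
    using mult by (simp add: hom_def units_of_carrier units_of_mult flip: chi_def)
qed

section \<open>Reduction of matrices modulo the maximal ideal\<close>

context complete_local_ring
begin

lemma map_matrix_mult: "map_matrix \<pi> (A ** B) = map_matrix \<pi> A ** map_matrix \<pi> B"
  by (simp add: vec_eq_iff matrix_matrix_mult_def residue_sum)

lemma map_matrix_mat [simp]: "map_matrix \<pi> (mat c) = mat (\<pi> c)"
  by (simp add: vec_eq_iff mat_def)

lemma map_matrix_surj:
  obtains A where "map_matrix \<pi> A = B"
proof
  show "map_matrix \<pi> (\<chi> i j. inv_into UNIV \<pi> (B $ i $ j)) = B"
    by (simp add: vec_eq_iff surj_f_inv_f[OF surj_residue])
qed

lemma invertible_map_matrix_iff: "invertible (map_matrix \<pi> A) \<longleftrightarrow> invertible A"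
  for A :: "'r ^ 2 ^ 2"
proof
  assume "invertible (map_matrix \<pi> A)"
  moreover have "det (map_matrix \<pi> A) = \<pi> (det A)" by (simp add: det_2)
  ultimately show "invertible A"
    by (simp add: invertible_det_nz invertible_if_det_unit is_unit_iff_residue)
next
  assume "invertible A"
  then obtain B where "A ** B = mat 1" "B ** A = mat 1" by (auto simp: invertible_def)
  then show "invertible (map_matrix \<pi> A)"
    unfolding invertible_def by (metis map_matrix_mat map_matrix_mult residue_1)
qed

lemma map_matrix_Ad:
  assumes "invertible P"
  shows "map_matrix \<pi> (Ad P A) = Ad (map_matrix \<pi> P) (map_matrix \<pi> A)"
proof -
  have "P ** A = Ad P A ** P" using Ad_eq_iff[OF assms] by blast
  then have "map_matrix \<pi> P ** map_matrix \<pi> A = map_matrix \<pi> (Ad P A) ** map_matrix \<pi> P"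
    by (metis map_matrix_mult)
  then show ?thesis using assms by (metis Ad_eq_iff invertible_map_matrix_iff)
qed

text \<open>
  The rows \<open>(1, u)\<close> and \<open>(v, 1)\<close> are left eigenvectors of \<open>D\<close> if \<open>u\<close> and \<open>v\<close> solve quadratic
  equations whose leading and constant coefficients are the off-diagonal entries of \<open>D\<close>.
\<close>

lemma diagonalize_residually_diagonal:
  fixes D :: "'r ^ 2 ^ 2"
  assumes diagonal: "diagonal (map_matrix \<pi> D)" and distinct: "\<pi> (D $ 1 $ 1) \<noteq> \<pi> (D $ 2 $ 2)"
  obtains U where "map_matrix \<pi> U = mat 1" "diagonal (Ad U D)"
proof -
  have off_diagonal: "\<pi> (D $ 1 $ 2) = 0" "\<pi> (D $ 2 $ 1) = 0"
    using diagonal by (simp_all add: diagonal_2)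
  have units: "D $ 1 $ 1 - D $ 2 $ 2 dvd 1" "D $ 2 $ 2 - D $ 1 $ 1 dvd 1"
    using distinct by (simp_all add: is_unit_iff_residue)
  obtain u where u: "\<pi> u = 0"
    "D $ 2 $ 1 * u * u + (D $ 1 $ 1 - D $ 2 $ 2) * u + - D $ 1 $ 2 = 0"
    by (rule quadratic_root_in_max_ideal[of "D $ 2 $ 1" "D $ 1 $ 1 - D $ 2 $ 2" "- D $ 1 $ 2"])
      (use units off_diagonal in simp_all)
  obtain v where v: "\<pi> v = 0"
    "D $ 1 $ 2 * v * v + (D $ 2 $ 2 - D $ 1 $ 1) * v + - D $ 2 $ 1 = 0"
    by (rule quadratic_root_in_max_ideal[of "D $ 1 $ 2" "D $ 2 $ 2 - D $ 1 $ 1" "- D $ 2 $ 1"])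
      (use units off_diagonal in simp_all)
  define U :: "'r ^ 2 ^ 2" where "U = vector [vector [1, u], vector [v, 1]]"
  define E :: "'r ^ 2 ^ 2" where
    "E = vector [vector [D $ 1 $ 1 + u * D $ 2 $ 1, 0], vector [0, D $ 2 $ 2 + v * D $ 1 $ 2]]"
  have residue_U: "map_matrix \<pi> U = mat 1"
    unfolding matrix_eq_2 by (simp add: U_def mat_def u v)
  then have "invertible (map_matrix \<pi> U)" by (auto simp: invertible_def)
  then have "invertible U" by (simp add: invertible_map_matrix_iff)
  moreover have "U ** D = E ** U"
    unfolding matrix_eq_2 using u(2) v(2) by (simp add: matrix_mult_2 U_def E_def algebra_simps)
  ultimately have "Ad U D = E" by (simp add: Ad_eq_iff)
  then have "diagonal (Ad U D)" by (simp add: diagonal_2 E_def)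
  with residue_U show thesis by (rule that)
qed

lemma lift_diagonalization:
  fixes D :: "'r ^ 2 ^ 2"
  assumes P: "invertible P" and diagonal: "diagonal (Ad P (map_matrix \<pi> D))"
    and distinct: "Ad P (map_matrix \<pi> D) $ 1 $ 1 \<noteq> Ad P (map_matrix \<pi> D) $ 2 $ 2"
  obtains N where "invertible N" "map_matrix \<pi> N = P" "diagonal (Ad N D)"
    "\<And>i j. i \<noteq> j \<Longrightarrow> Ad N D $ i $ i - Ad N D $ j $ j dvd 1"
proof -
  obtain P' where P': "map_matrix \<pi> P' = P" by (rule map_matrix_surj)
  then have invertible_P': "invertible P'" using P invertible_map_matrix_iff by blast
  have residue_P': "map_matrix \<pi> (Ad P' D) = Ad P (map_matrix \<pi> D)"
    by (simp add: map_matrix_Ad[OF invertible_P'] P')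
  then have "\<pi> (Ad P' D $ i $ i) = Ad P (map_matrix \<pi> D) $ i $ i" for i
    by (simp flip: residue_P')
  then obtain U where U: "map_matrix \<pi> U = mat 1" "diagonal (Ad U (Ad P' D))"
    using diagonalize_residually_diagonal[of "Ad P' D"] diagonal distinct by (metis residue_P')
  have "invertible (map_matrix \<pi> U)" unfolding U(1) by (auto simp: invertible_def)
  then have invertible_U: "invertible U" by (simp add: invertible_map_matrix_iff)
  define N where "N = U ** P'"
  have N: "invertible N" unfolding N_def using invertible_U invertible_P' by (rule invertible_mult)
  have residue_N: "map_matrix \<pi> N = P" by (simp add: N_def map_matrix_mult U P')
  have "diagonal (Ad N D)"
    using U(2) by (simp add: N_def Ad_matrix_mult[OF invertible_U invertible_P'])
  moreover have "Ad N D $ i $ i - Ad N D $ j $ j dvd 1" if "i \<noteq> j" for i j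
  proof -
    have "\<pi> (Ad N D $ k $ k) = Ad P (map_matrix \<pi> D) $ k $ k" for k
      using map_matrix_Ad[OF N, of D] by (metis residue_N nth_map_matrix)
    then show ?thesis
      using that distinct exhaust_2[of i] exhaust_2[of j] by (auto simp: is_unit_iff_residue)
  qed
  ultimately show thesis using that N residue_N by blast
qed

definition max_ideal_pow_mat :: "nat \<Rightarrow> ('r ^ 'n ^ 'm) set" where
  "max_ideal_pow_mat n = {A. \<forall>i j. A $ i $ j \<in> \<mm> n}"

lemma max_ideal_pow_mat_add:
  "A \<in> max_ideal_pow_mat n \<Longrightarrow> B \<in> max_ideal_pow_mat n \<Longrightarrow> A + B \<in> max_ideal_pow_mat n"
  by (simp add: max_ideal_pow_mat_def max_ideal_pow_add)

lemma max_ideal_pow_mat_minus: "A \<in> max_ideal_pow_mat n \<Longrightarrow> - A \<in> max_ideal_pow_mat n"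
  by (simp add: max_ideal_pow_mat_def max_ideal_pow_minus)

lemma max_ideal_pow_mat_mult_left: "B \<in> max_ideal_pow_mat n \<Longrightarrow> A ** B \<in> max_ideal_pow_mat n"
  by (simp add: max_ideal_pow_mat_def matrix_matrix_mult_def max_ideal_pow_sum
      max_ideal_pow_mult_left)

lemma max_ideal_pow_mat_mult_right: "A \<in> max_ideal_pow_mat n \<Longrightarrow> A ** B \<in> max_ideal_pow_mat n"
  by (simp add: max_ideal_pow_mat_def matrix_matrix_mult_def max_ideal_pow_sum
      max_ideal_pow_mult_right)

end

section \<open>The adic topology\<close>

context complete_local_ring
begin

lemma openin_adic_ball: "openin adic_topology {y. y - x \<in> \<mm> n}"
  unfolding adic_topology_def by (rule topology_generated_by_Basis) blast

lemma openin_adic_iff: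
  "openin adic_topology U \<longleftrightarrow> (\<forall>x\<in>U. \<exists>n. {y. y - x \<in> \<mm> n} \<subseteq> U)"
proof
  assume "openin adic_topology U"
  then have "generate_topology_on {{y. y - x \<in> \<mm> n} | x n. True} U"
    by (simp add: adic_topology_def openin_topology_generated_by_iff)
  then show "\<forall>x\<in>U. \<exists>n. {y. y - x \<in> \<mm> n} \<subseteq> U"
  proof induction
    case Empty
    show ?case by simp
  next
    case (Int U V)
    show ?case
    proof
      fix x assume "x \<in> U \<inter> V"
      then obtain m n where "{y. y - x \<in> \<mm> m} \<subseteq> U" "{y. y - x \<in> \<mm> n} \<subseteq> V"
        using Int.IH by blast
      then have "{y. y - x \<in> \<mm> (max m n)} \<subseteq> U \<inter> V"
        using max_ideal_pow_antimono[of m "max m n"] max_ideal_pow_antimono[of n "max m n"] by auto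
      then show "\<exists>n. {y. y - x \<in> \<mm> n} \<subseteq> U \<inter> V" by blast
    qed
  next
    case (UN \<U>)
    then show ?case by (meson Union_iff Union_upper subset_trans)
  next
    case (Basis U)
    then show ?case by (auto intro: max_ideal_pow_diff_trans)
  qed
next
  assume nbhd: "\<forall>x\<in>U. \<exists>n. {y. y - x \<in> \<mm> n} \<subseteq> U"
  have "\<exists>V. openin adic_topology V \<and> x \<in> V \<and> V \<subseteq> U" if x: "x \<in> U" for x
  proof -
    obtain n where "{y. y - x \<in> \<mm> n} \<subseteq> U" using nbhd x by blast
    moreover have "x \<in> {y. y - x \<in> \<mm> n}" by simp
    ultimately show ?thesis using openin_adic_ball by blast
  qed
  then show "openin adic_topology U" by (subst openin_subopen) blast
qed

lemma topspace_adic [simp]: "topspace (adic_topology :: 'r topology) = UNIV"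
  using openin_subset[OF openin_adic_ball[of 0 0]] by auto

lemma closedin_max_ideal_pow: "closedin adic_topology (\<mm> n)"
proof -
  have "{y. y - x \<in> \<mm> n} \<subseteq> - \<mm> n" if "x \<notin> \<mm> n" for x
    using that max_ideal_pow_diff[of _ n] by fastforce
  then have "openin adic_topology (- \<mm> n)" unfolding openin_adic_iff by blast
  then show ?thesis by (simp add: closedin_def Compl_eq_Diff_UNIV)
qed

lemma continuous_map_adic_iff:
  "continuous_map S adic_topology f \<longleftrightarrow>
    (\<forall>x\<in>topspace S. \<forall>n. \<forall>\<^sub>F y in atin S x. f y - f x \<in> \<mm> n)"
proof -
  have "limitin adic_topology f l F \<longleftrightarrow> (\<forall>n. \<forall>\<^sub>F y in F. f y - l \<in> \<mm> n)" for l F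
  proof
    assume "limitin adic_topology f l F"
    then have "\<forall>\<^sub>F y in F. f y \<in> {z. z - l \<in> \<mm> n}" for n
      using openin_adic_ball[of l n] unfolding limitin_def by fastforce
    then show "\<forall>n. \<forall>\<^sub>F y in F. f y - l \<in> \<mm> n" by simp
  next
    assume near: "\<forall>n. \<forall>\<^sub>F y in F. f y - l \<in> \<mm> n"
    have "\<forall>\<^sub>F y in F. f y \<in> U" if U: "openin adic_topology U" "l \<in> U" for U
    proof -
      obtain n where "{y. y - l \<in> \<mm> n} \<subseteq> U" using U unfolding openin_adic_iff by blast
      then show ?thesis using near by (auto elim!: allE[of _ n] eventually_mono)
    qed
    then show "limitin adic_topology f l F" by (simp add: limitin_def)
  qed
  then show ?thesis by (simp add: continuous_map_atin)
qed

lemma topspace_GL2_topology [simp]: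
  "topspace (GL2_topology (adic_topology :: 'r topology)) = carrier GL2"
  by (simp add: GL2_topology_def topspace_pullback_topology)

lemma continuous_map_GL2_iff_entries:
  fixes F :: "'a \<Rightarrow> 'r ^ 2 ^ 2"
  shows
  "continuous_map S (GL2_topology adic_topology) F \<longleftrightarrow>
    F \<in> topspace S \<rightarrow> carrier GL2 \<and> (\<forall>i j. continuous_map S adic_topology (\<lambda>x. F x $ i $ j))"
proof -
  let ?entries = "\<lambda>A :: 'r ^ 2 ^ 2. \<lambda>(i, j). A $ i $ j"
  have "continuous_map S (product_topology (\<lambda>_. adic_topology) UNIV) (?entries \<circ> F) \<longleftrightarrow>
      (\<forall>i j. continuous_map S adic_topology (\<lambda>x. F x $ i $ j))"
    by (simp add: continuous_map_componentwise_UNIV)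
  moreover have "continuous_map S (GL2_topology adic_topology) F \<longleftrightarrow>
      F \<in> topspace S \<rightarrow> carrier GL2 \<and>
      continuous_map S (product_topology (\<lambda>_. adic_topology) UNIV) (?entries \<circ> F)"
  proof (intro iffI conjI)
    assume F: "continuous_map S (GL2_topology adic_topology) F"
    then show "F \<in> topspace S \<rightarrow> carrier GL2" using continuous_map_funspace by fastforce
    have "continuous_map (GL2_topology adic_topology) (product_topology (\<lambda>_. adic_topology) UNIV)
        (id \<circ> ?entries)"
      unfolding GL2_topology_def by (rule continuous_map_pullback) simp
    then show "continuous_map S (product_topology (\<lambda>_. adic_topology) UNIV) (?entries \<circ> F)"
      using continuous_map_compose[OF F] by simp
  next
    assume "F \<in> topspace S \<rightarrow> carrier GL2 \<and>
      continuous_map S (product_topology (\<lambda>_. adic_topology) UNIV) (?entries \<circ> F)"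
    then show "continuous_map S (GL2_topology adic_topology) F"
      unfolding GL2_topology_def by (intro continuous_map_pullback') auto
  qed
  ultimately show ?thesis by blast
qed

lemma continuous_map_GL2_iff:
  fixes F :: "'a \<Rightarrow> 'r ^ 2 ^ 2"
  shows
  "continuous_map S (GL2_topology adic_topology) F \<longleftrightarrow>
    F \<in> topspace S \<rightarrow> carrier GL2 \<and>
    (\<forall>x\<in>topspace S. \<forall>n. \<forall>\<^sub>F y in atin S x. F y - F x \<in> max_ideal_pow_mat n)"
proof -
  have "(\<forall>\<^sub>F y in G. M y \<in> max_ideal_pow_mat n) \<longleftrightarrow> (\<forall>i j. \<forall>\<^sub>F y in G. M y $ i $ j \<in> \<mm> n)"
    for M :: "'a \<Rightarrow> 'r ^ 2 ^ 2" and G n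
    unfolding max_ideal_pow_mat_def
    by (auto intro!: eventually_all_finite elim: eventually_mono)
  then show ?thesis
    unfolding continuous_map_GL2_iff_entries continuous_map_adic_iff by auto
qed

lemma continuous_map_GL2_mult:
  fixes F K :: "'a \<Rightarrow> 'r ^ 2 ^ 2"
  assumes F: "continuous_map S (GL2_topology adic_topology) F"
    and K: "continuous_map S (GL2_topology adic_topology) K"
  shows "continuous_map S (GL2_topology adic_topology) (\<lambda>x. F x ** K x)"
  unfolding continuous_map_GL2_iff
proof (intro conjI ballI allI)
  show "(\<lambda>x. F x ** K x) \<in> topspace S \<rightarrow> carrier GL2"
    using F K by (auto simp: continuous_map_GL2_iff Pi_iff intro!: invertible_mult)
  fix x n assume x: "x \<in> topspace S"
  have "\<forall>\<^sub>F y in atin S x. F y - F x \<in> max_ideal_pow_mat n"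
    "\<forall>\<^sub>F y in atin S x. K y - K x \<in> max_ideal_pow_mat n"
    using F K x by (simp_all add: continuous_map_GL2_iff)
  then show "\<forall>\<^sub>F y in atin S x. F y ** K y - F x ** K x \<in> max_ideal_pow_mat n"
  proof eventually_elim
    case (elim y)
    have "F y ** K y - F x ** K x = F y ** (K y - K x) + (F y - F x) ** K x"
      by (simp add: matrix_diff_ldistrib matrix_diff_rdistrib)
    then show ?case
      using elim by (simp add: max_ideal_pow_mat_add max_ideal_pow_mat_mult_left
          max_ideal_pow_mat_mult_right)
  qed
qed

lemma continuous_map_GL2_inv:
  fixes F :: "'a \<Rightarrow> 'r ^ 2 ^ 2"
  assumes F: "continuous_map S (GL2_topology adic_topology) F"
  shows "continuous_map S (GL2_topology adic_topology) (\<lambda>x. inv\<^bsub>GL2\<^esub> F x)"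
  unfolding continuous_map_GL2_iff
proof (intro conjI ballI allI)
  have invertible: "invertible (F x)" if "x \<in> topspace S" for x
    using F that by (auto simp: continuous_map_GL2_iff)
  then show "(\<lambda>x. inv\<^bsub>GL2\<^esub> F x) \<in> topspace S \<rightarrow> carrier GL2" by (simp add: GL2_inv)
  fix x n assume x: "x \<in> topspace S"
  have "\<forall>\<^sub>F y in atin S x. F y - F x \<in> max_ideal_pow_mat n"
    using F x by (simp add: continuous_map_GL2_iff)
  moreover have "\<forall>\<^sub>F y in atin S x. y \<in> topspace S"
    unfolding eventually_atin by blast
  ultimately show "\<forall>\<^sub>F y in atin S x. inv\<^bsub>GL2\<^esub> F y - inv\<^bsub>GL2\<^esub> F x \<in> max_ideal_pow_mat n"
  proof eventually_elim
    case (elim y)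
    have "inv\<^bsub>GL2\<^esub> F y ** - (F y - F x) ** inv\<^bsub>GL2\<^esub> F x = inv\<^bsub>GL2\<^esub> F y - inv\<^bsub>GL2\<^esub> F x"
      using GL2_inv[OF invertible[OF x]] GL2_inv[OF invertible[OF elim(2)]]
      by (simp add: matrix_diff_ldistrib matrix_diff_rdistrib flip: matrix_mul_assoc)
    then show ?case
      using elim(1) by (metis max_ideal_pow_mat_minus max_ideal_pow_mat_mult_left
          max_ideal_pow_mat_mult_right)
  qed
qed

lemma topological_group_GL2:
  "topological_group (GL2 :: ('r ^ 2 ^ 2) monoid) (GL2_topology adic_topology)"
proof -
  let ?\<G> = "GL2_topology (adic_topology :: 'r topology)"
  have "continuous_map (prod_topology ?\<G> ?\<G>) ?\<G> (\<lambda>(x, y). x ** y)"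
    unfolding case_prod_beta
    by (intro continuous_map_GL2_mult continuous_map_fst continuous_map_snd)
  moreover have "continuous_map ?\<G> ?\<G> (\<lambda>x. inv\<^bsub>GL2\<^esub> x)"
    by (intro continuous_map_GL2_inv continuous_map_id[unfolded id_def])
  ultimately show ?thesis
    by (simp add: topological_group_def group_GL2)
qed

lemma continuous_map_Ad_entry:
  fixes F :: "'a \<Rightarrow> 'r ^ 2 ^ 2"
  assumes P: "invertible P" and F: "continuous_map S (GL2_topology adic_topology) F"
  shows "continuous_map S adic_topology (\<lambda>x. Ad P (F x) $ i $ j)"
proof -
  have "continuous_map S (GL2_topology adic_topology) (\<lambda>x. P ** F x ** inv\<^bsub>GL2\<^esub> P)"
    using P GL2_inv(1)[OF P] by (intro continuous_map_GL2_mult F) simp_all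
  then show ?thesis by (simp add: continuous_map_GL2_iff_entries Ad_def)
qed

lemma continuous_map_residue:
  "continuous_map (GL2_topology adic_topology) (discrete_topology UNIV) (map_matrix \<pi>)"
proof -
  have "limitin (discrete_topology UNIV) (map_matrix \<pi>) (map_matrix \<pi> A)
      (atin (GL2_topology adic_topology) A)" if A: "A \<in> carrier GL2" for A
  proof -
    have "continuous_map (GL2_topology adic_topology) (GL2_topology adic_topology)
        (\<lambda>A :: 'r ^ 2 ^ 2. A)"
      by simp
    then have "\<forall>\<^sub>F B in atin (GL2_topology adic_topology) A. B - A \<in> max_ideal_pow_mat 1"
      using A unfolding continuous_map_GL2_iff topspace_GL2_topology by blast
    then have "\<forall>\<^sub>F B in atin (GL2_topology adic_topology) A. map_matrix \<pi> B = map_matrix \<pi> A"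
      by eventually_elim (simp add: max_ideal_pow_mat_def mem_max_ideal_pow_Suc_0_iff vec_eq_iff)
    then show ?thesis by (auto simp: limitin_def elim: eventually_mono)
  qed
  then show ?thesis by (simp add: continuous_map_atin)
qed

end

section \<open>Topological groups\<close>

lemma topological_group_subgroup:
  assumes G: "topological_group G T" and H: "subgroup H G"
  shows "topological_group (G\<lparr>carrier := H\<rparr>) (subtopology T H)"
proof -
  interpret group G using G by (simp add: topological_group_def)
  let ?S = "subtopology T H"
  have H_subset: "H \<subseteq> topspace T"
    using G subgroup.subset[OF H] by (simp add: topological_group_def)
  have "continuous_map (prod_topology T T) T (\<lambda>(x, y). x \<otimes>\<^bsub>G\<^esub> y)"
    and inv: "continuous_map T T (\<lambda>x. inv\<^bsub>G\<^esub> x)"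
    using G by (simp_all add: topological_group_def)
  then have "continuous_map (prod_topology ?S ?S) ?S (\<lambda>(x, y). x \<otimes>\<^bsub>G\<^esub> y)"
    using subgroup.m_closed[OF H]
    by (auto simp: prod_topology_subtopology continuous_map_from_subtopology
        intro!: continuous_map_into_subtopology)
  moreover have "continuous_map ?S ?S (\<lambda>x. inv\<^bsub>G\<^esub> x)"
    using inv subgroup.m_inv_closed[OF H]
    by (auto simp: continuous_map_from_subtopology intro!: continuous_map_into_subtopology)
  then have "continuous_map ?S ?S (\<lambda>x. inv\<^bsub>G\<lparr>carrier := H\<rparr>\<^esub> x)"
    by (rule continuous_map_eq) (simp add: m_inv_consistent[OF H])
  ultimately show ?thesis
    using H_subset by (simp add: topological_group_def subgroup_imp_group[OF H] Int_absorb1)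
qed

locale topological_group_retraction = group K for K (structure) +
  fixes T :: "'a topology" and r :: "'a \<Rightarrow> 'a"
  assumes topological_group: "topological_group K T"
    and retraction_hom: "r \<in> hom K K"
    and continuous_retraction: "continuous_map T T r"
    and retraction_idem: "x \<in> carrier K \<Longrightarrow> r (r x) = r x"
    and kernel_image_commute: "x \<in> kernel K K r \<Longrightarrow> y \<in> carrier K \<Longrightarrow> x \<otimes> r y = r y \<otimes> x"
begin

sublocale retraction: group_hom K K r
  by unfold_locales (rule retraction_hom)

lemma topspace_eq_carrier: "topspace T = carrier K"
  using topological_group by (simp add: topological_group_def)

lemma topspace_kernel_image:
  "topspace (prod_topology (subtopology T (kernel K K r)) (subtopology T (r ` carrier K))) =
    kernel K K r \<times> r ` carrier K"
proof -
  have "kernel K K r \<subseteq> carrier K" "r ` carrier K \<subseteq> carrier K" by (auto simp: kernel_def)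
  then show ?thesis by (simp add: topspace_eq_carrier Int_absorb1)
qed

lemma retraction_kernel_mult:
  assumes "x \<in> kernel K K r" "y \<in> r ` carrier K"
  shows "r (x \<otimes> y) = y"
  using assms retraction_idem by (auto simp: kernel_def)

lemma continuous_map_mult:
  assumes "continuous_map S T f" "continuous_map S T g"
  shows "continuous_map S T (\<lambda>x. f x \<otimes> g x)"
proof -
  have "continuous_map (prod_topology T T) T (\<lambda>(x, y). x \<otimes> y)"
    using topological_group by (simp add: topological_group_def)
  from continuous_map_compose[OF continuous_map_pairedI[OF assms] this]
  show ?thesis by (simp add: comp_def)
qed

lemma homeomorphic_maps_kernel_image:
  "homeomorphic_maps
    (prod_topology (subtopology T (kernel K K r)) (subtopology T (r ` carrier K))) T
    (\<lambda>(x, y). x \<otimes> y) (\<lambda>z. (z \<otimes> inv (r z), r z))"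
proof -
  let ?X = "prod_topology (subtopology T (kernel K K r)) (subtopology T (r ` carrier K))"
  have "continuous_map ?X T (\<lambda>(x, y). x \<otimes> y)"
    unfolding case_prod_beta
    by (intro continuous_map_mult continuous_map_into_fulltopology[OF continuous_map_fst]
        continuous_map_into_fulltopology[OF continuous_map_snd])
  moreover have "continuous_map T ?X (\<lambda>z. (z \<otimes> inv (r z), r z))"
  proof (intro continuous_map_pairedI continuous_map_into_subtopology continuous_retraction)
    have "continuous_map T T (\<lambda>x. inv x)"
      using topological_group by (simp add: topological_group_def)
    from continuous_map_compose[OF continuous_retraction this]
    show "continuous_map T T (\<lambda>z. z \<otimes> inv (r z))"
      by (intro continuous_map_mult) (simp_all add: comp_def)
    show "(\<lambda>z. z \<otimes> inv (r z)) \<in> topspace T \<rightarrow> kernel K K r"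
      by (auto simp: topspace_eq_carrier kernel_def retraction_idem)
  qed (simp add: topspace_eq_carrier)
  ultimately show ?thesis
    unfolding homeomorphic_maps_def topspace_kernel_image topspace_eq_carrier
    by (auto simp: retraction_kernel_mult m_assoc kernel_def)
qed

lemma topologically_isomorphic_kernel_image:
  "topologically_isomorphic
    (K\<lparr>carrier := kernel K K r\<rparr> \<times>\<times> K\<lparr>carrier := r ` carrier K\<rparr>)
    (prod_topology (subtopology T (kernel K K r)) (subtopology T (r ` carrier K))) K T"
proof -
  let ?A = "kernel K K r" and ?B = "r ` carrier K"
  let ?X = "prod_topology (subtopology T ?A) (subtopology T ?B)"
  let ?f = "\<lambda>(x, y). x \<otimes> y"
  have homeomorphic: "homeomorphic_map ?X T ?f"
    using homeomorphic_maps_kernel_image homeomorphic_map_maps by blast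
  have bij: "bij_betw ?f (?A \<times> ?B) (carrier K)"
    using homeomorphic_imp_surjective_map[OF homeomorphic]
      homeomorphic_imp_injective_map[OF homeomorphic]
    unfolding bij_betw_def topspace_kernel_image topspace_eq_carrier by blast
  have "?f \<in> hom (K\<lparr>carrier := ?A\<rparr> \<times>\<times> K\<lparr>carrier := ?B\<rparr>) K"
  proof (rule homI; clarsimp simp: DirProd_def)
    show "x \<otimes> r y \<in> carrier K" if "x \<in> ?A" "y \<in> carrier K" for x y
      using that by (simp add: kernel_def)
    fix x y x' y' assume mem: "x \<in> ?A" "y \<in> carrier K" "x' \<in> ?A" "y' \<in> carrier K"
    then have carrier: "x \<in> carrier K" "x' \<in> carrier K" by (simp_all add: kernel_def)
    have "x \<otimes> x' \<otimes> (r y \<otimes> r y') = x \<otimes> (x' \<otimes> r y) \<otimes> r y'"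
      using mem carrier by (simp add: m_assoc)
    also have "\<dots> = x \<otimes> r y \<otimes> (x' \<otimes> r y')"
      unfolding kernel_image_commute[OF mem(3,2)] using mem carrier by (simp add: m_assoc)
    finally show "x \<otimes> x' \<otimes> (r y \<otimes> r y') = x \<otimes> r y \<otimes> (x' \<otimes> r y')" .
  qed
  then have "?f \<in> iso (K\<lparr>carrier := ?A\<rparr> \<times>\<times> K\<lparr>carrier := ?B\<rparr>) K"
    using bij by (simp add: iso_def DirProd_def)
  then show ?thesis using homeomorphic unfolding topologically_isomorphic_def by blast
qed

end

lemma frattini_subset_topspace: "frattini p K T \<subseteq> topspace T"
  by (simp add: frattini_def closure_of_subset_topspace)

lemma one_in_frattini:
  assumes "group K" "\<one>\<^bsub>K\<^esub> \<in> topspace T"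
  shows "\<one>\<^bsub>K\<^esub> \<in> frattini p K T"
proof -
  interpret group K by fact
  let ?P = "generate K {x [^]\<^bsub>K\<^esub> p | x. x \<in> carrier K}" and ?D = "derived K (carrier K)"
  have "\<one>\<^bsub>K\<^esub> \<in> ?P" "\<one>\<^bsub>K\<^esub> \<in> ?D" unfolding derived_def by (rule generate.one)+
  then have "\<one>\<^bsub>K\<^esub> \<in> ?P <#>\<^bsub>K\<^esub> ?D" unfolding set_mult_def using r_one[OF one_closed] by force
  then show ?thesis using assms(2) closure_of_subset_Int[of T] by (auto simp: frattini_def)
qed

lemma frattini_subset_kernel:
  assumes "group K" "comm_group A" and hom: "h \<in> hom K A"
    and exponent: "\<And>x. x \<in> carrier K \<Longrightarrow> h x [^]\<^bsub>A\<^esub> p = \<one>\<^bsub>A\<^esub>"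
    and closed: "closedin T (kernel K A h)"
  shows "frattini p K T \<subseteq> kernel K A h"
proof -
  interpret A: comm_group A by fact
  interpret group_hom K A h
    using assms(1) hom by (intro group_hom.intro group_hom_axioms.intro A.is_group)
  let ?N = "kernel K A h"
  have "{x [^]\<^bsub>K\<^esub> p | x. x \<in> carrier K} \<subseteq> ?N"
    using exponent by (auto simp: kernel_def hom_nat_pow)
  then have powers: "generate K {x [^]\<^bsub>K\<^esub> p | x. x \<in> carrier K} \<subseteq> ?N"
    using subgroup_kernel by (rule generate_subgroup_incl)
  have "h (x \<otimes>\<^bsub>K\<^esub> y \<otimes>\<^bsub>K\<^esub> inv\<^bsub>K\<^esub> x \<otimes>\<^bsub>K\<^esub> inv\<^bsub>K\<^esub> y) = \<one>\<^bsub>A\<^esub>"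
    if "x \<in> carrier K" "y \<in> carrier K" for x y
    using that A.m_comm[of "h x" "h y"] by (simp add: A.m_assoc A.inv_solve_right')
  then have "derived_set K (carrier K) \<subseteq> ?N" by (auto simp: kernel_def)
  then have derived: "derived K (carrier K) \<subseteq> ?N"
    unfolding derived_def using subgroup_kernel by (rule generate_subgroup_incl)
  have "generate K {x [^]\<^bsub>K\<^esub> p | x. x \<in> carrier K} <#>\<^bsub>K\<^esub> derived K (carrier K) \<subseteq> ?N"
    using powers derived subgroup.m_closed[OF subgroup_kernel] by (fastforce simp: set_mult_def)
  then show ?thesis unfolding frattini_def using closed by (rule closure_of_minimal)
qed

lemma frattini_additive_mod_ideal:
  fixes b :: "'a \<Rightarrow> 'r::comm_ring_1"
  assumes K: "group K" and I: "ideal I type_ring"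
    and additive: "\<And>x y. x \<in> carrier K \<Longrightarrow> y \<in> carrier K \<Longrightarrow> b (x \<otimes>\<^bsub>K\<^esub> y) - (b x + b y) \<in> I"
    and torsion: "\<And>x. x \<in> carrier K \<Longrightarrow> of_nat p * b x \<in> I"
    and closed: "closedin T {x \<in> carrier K. b x \<in> I}"
    and z: "z \<in> frattini p K T"
  shows "b z \<in> I"
proof -
  define Q where "Q = (type_ring :: 'r ring) Quot I"
  interpret ideal I "type_ring :: 'r ring" by fact
  interpret Q: ring Q unfolding Q_def by (rule quotient_is_ring)
  define q where "q = (+>\<^bsub>type_ring\<^esub>) I"
  interpret q: ring_hom_ring "type_ring :: 'r ring" Q q
    unfolding Q_def q_def by (rule rcos_ring_hom_ring)
  have q_eq_iff: "q x = q y \<longleftrightarrow> x - y \<in> I" for x y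
    using type_ring.quotient_eq_iff_same_a_r_cos[OF I, of x y] by (simp add: q_def)
  have q_eq_0_iff: "q x = \<zero>\<^bsub>Q\<^esub> \<longleftrightarrow> x \<in> I" for x
    using q_eq_iff[of x 0] q.hom_zero by simp
  have "q (b (x \<otimes>\<^bsub>K\<^esub> y)) = q (b x) \<oplus>\<^bsub>Q\<^esub> q (b y)" if "x \<in> carrier K" "y \<in> carrier K" for x y
    using additive[OF that] q.hom_add[of "b x" "b y"] by (simp flip: q_eq_iff)
  then have hom: "(\<lambda>x. q (b x)) \<in> hom K (add_monoid Q)" by (intro homI) simp_all
  have exponent: "q (b x) [^]\<^bsub>add_monoid Q\<^esub> p = \<zero>\<^bsub>Q\<^esub>" if "x \<in> carrier K" for x
  proof -
    have "q (b x [^]\<^bsub>add_monoid type_ring\<^esub> p) = q (b x) [^]\<^bsub>add_monoid Q\<^esub> p"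
      by (rule group_hom.hom_nat_pow[OF q.a_group_hom]) simp
    moreover have "q (of_nat p * b x) = \<zero>\<^bsub>Q\<^esub>" using torsion[OF that] by (simp add: q_eq_0_iff)
    ultimately show ?thesis unfolding type_ring_add_pow by metis
  qed
  have kernel: "kernel K (add_monoid Q) (\<lambda>x. q (b x)) = {x \<in> carrier K. b x \<in> I}"
    by (simp add: kernel_def q_eq_0_iff)
  have "closedin T (kernel K (add_monoid Q) (\<lambda>x. q (b x)))" unfolding kernel by (rule closed)
  then have "frattini p K T \<subseteq> kernel K (add_monoid Q) (\<lambda>x. q (b x))"
    using exponent by (intro frattini_subset_kernel K Q.a_comm_group hom) simp_all
  then show ?thesis using z unfolding kernel by blast
qed

section \<open>Residually trivial subgroups\<close>

locale residually_trivial_group = complete_local_ring \<pi>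
  for \<pi> :: "'r::comm_ring_1 \<Rightarrow> 'f::field" +
  fixes p :: nat and \<Gamma> :: "('r ^ 2 ^ 2) set"
  assumes residue_char: "of_nat p = (0 :: 'f)"
    and subgroup_Gamma: "subgroup \<Gamma> GL2"
    and map_matrix_Gamma: "g \<in> \<Gamma> \<Longrightarrow> map_matrix \<pi> g = mat 1"
begin

sublocale Gamma: group "GL2\<lparr>carrier := \<Gamma>\<rparr>"
  using subgroup_Gamma by (rule GL2.subgroup_imp_group)

abbreviation (input) \<Gamma>_topology :: "('r ^ 2 ^ 2) topology" where
  "\<Gamma>_topology \<equiv> subtopology (GL2_topology adic_topology) \<Gamma>"

abbreviation (input) \<Phi> :: "('r ^ 2 ^ 2) set" where
  "\<Phi> \<equiv> frattini p (GL2\<lparr>carrier := \<Gamma>\<rparr>) \<Gamma>_topology"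

lemma invertible_Gamma: "g \<in> \<Gamma> \<Longrightarrow> invertible g"
  using subgroup.mem_carrier[OF subgroup_Gamma] by simp

lemma topspace_Gamma: "topspace \<Gamma>_topology = \<Gamma>"
  using invertible_Gamma by auto

lemma frattini_subset_Gamma: "\<Phi> \<subseteq> \<Gamma>"
  using frattini_subset_topspace[where T = \<Gamma>_topology] unfolding topspace_Gamma .

context
  fixes N :: "'r ^ 2 ^ 2"
  assumes N: "invertible N"
begin

lemma map_matrix_Ad_Gamma: "g \<in> \<Gamma> \<Longrightarrow> map_matrix \<pi> (Ad N g) = mat 1"
  using N by (simp add: map_matrix_Ad map_matrix_Gamma Ad_mat_1 invertible_map_matrix_iff)

lemma Ad_entry_mult:
  assumes "i \<noteq> j" and g: "g \<in> \<Gamma>" "Ad N g $ i $ j \<in> \<mm> k" and h: "h \<in> \<Gamma>" "Ad N h $ i $ j \<in> \<mm> k"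
  shows "Ad N (g ** h) $ i $ j - (Ad N g $ i $ j + Ad N h $ i $ j) \<in> \<mm> (Suc k)"
proof -
  have residue: "\<pi> (Ad N g $ i $ i - 1) = 0" "\<pi> (Ad N h $ j $ j - 1) = 0"
    using map_matrix_Ad_Gamma[OF g(1)] map_matrix_Ad_Gamma[OF h(1)]
    by (simp_all add: vec_eq_iff mat_def)
  have indices: "(UNIV :: 2 set) = {i, j}"
    using assms(1) exhaust_2[of i] exhaust_2[of j] by (auto simp: UNIV_2)
  have "(A ** B) $ i $ j = A $ i $ i * B $ i $ j + A $ i $ j * B $ j $ j" for A B :: "'r ^ 2 ^ 2"
    using assms(1) by (simp add: matrix_matrix_mult_def indices)
  then have "Ad N (g ** h) $ i $ j - (Ad N g $ i $ j + Ad N h $ i $ j) =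
      Ad N h $ i $ j * (Ad N g $ i $ i - 1) + Ad N g $ i $ j * (Ad N h $ j $ j - 1)"
    unfolding Ad_mult[OF N] by (simp add: algebra_simps)
  then show ?thesis
    using max_ideal_pow_mult_Suc[OF h(2) residue(1)] max_ideal_pow_mult_Suc[OF g(2) residue(2)]
    by (simp add: max_ideal_pow_add)
qed

lemma Ad_entry_frattini:
  assumes "i \<noteq> j" and entries: "\<And>g. g \<in> \<Gamma> \<Longrightarrow> Ad N g $ i $ j \<in> \<mm> k" and z: "z \<in> \<Phi>"
  shows "Ad N z $ i $ j \<in> \<mm> (Suc k)"
proof (rule frattini_additive_mod_ideal[OF Gamma.is_group ideal_max_ideal_pow _ _ _ z])
  fix g h assume "g \<in> carrier (GL2\<lparr>carrier := \<Gamma>\<rparr>)" "h \<in> carrier (GL2\<lparr>carrier := \<Gamma>\<rparr>)"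
  then show "Ad N (g \<otimes>\<^bsub>GL2\<lparr>carrier := \<Gamma>\<rparr>\<^esub> h) $ i $ j - (Ad N g $ i $ j + Ad N h $ i $ j)
      \<in> \<mm> (Suc k)"
    using entries assms(1) by (simp add: Ad_entry_mult)
next
  fix g assume "g \<in> carrier (GL2\<lparr>carrier := \<Gamma>\<rparr>)"
  then have "Ad N g $ i $ j * of_nat p \<in> \<mm> (Suc k)"
    using entries residue_char by (intro max_ideal_pow_mult_Suc) simp_all
  then show "of_nat p * Ad N g $ i $ j \<in> \<mm> (Suc k)" by (simp add: mult.commute)
next
  have "continuous_map \<Gamma>_topology adic_topology (\<lambda>g. Ad N g $ i $ j)"
    by (intro continuous_map_Ad_entry N continuous_map_from_subtopology)
      (rule continuous_map_id[unfolded id_def])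
  from closedin_continuous_map_preimage[OF this closedin_max_ideal_pow[of "Suc k"]]
  show "closedin \<Gamma>_topology {g \<in> carrier (GL2\<lparr>carrier := \<Gamma>\<rparr>). Ad N g $ i $ j \<in> \<mm> (Suc k)}"
    unfolding topspace_Gamma by simp
qed

lemma Ad_entry_conj_frattini:
  assumes "i \<noteq> j" and entries: "\<And>g. g \<in> \<Gamma> \<Longrightarrow> Ad N g $ i $ j \<in> \<mm> k"
    and D: "diagonal (Ad N D)" and unit: "Ad N D $ i $ i - Ad N D $ j $ j dvd 1"
    and g: "g \<in> \<Gamma>" and z: "z \<in> \<Phi>" and conj: "D ** g = z ** g ** D"
  shows "Ad N g $ i $ j \<in> \<mm> (Suc k)"
proof -
  have "z \<in> \<Gamma>" using z frattini_subset_Gamma by blast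
  then have "Ad N (z ** g) $ i $ j - (Ad N z $ i $ j + Ad N g $ i $ j) \<in> \<mm> (Suc k)"
    using entries g assms(1) by (simp add: Ad_entry_mult)
  moreover have "Ad N z $ i $ j \<in> \<mm> (Suc k)"
    using entries z by (rule Ad_entry_frattini[OF assms(1)])
  ultimately have cong: "Ad N (z ** g) $ i $ j - Ad N g $ i $ j \<in> \<mm> (Suc k)"
    using max_ideal_pow_add by fastforce
  have "Ad N D ** Ad N g = Ad N (z ** g) ** Ad N D"
    using conj by (simp flip: Ad_mult[OF N])
  then have "Ad N D $ i $ i * Ad N g $ i $ j = Ad N (z ** g) $ i $ j * Ad N D $ j $ j"
    using D by (metis diagonal_mult_nth mult_diagonal_nth)
  then have "(Ad N D $ i $ i - Ad N D $ j $ j) * Ad N g $ i $ j =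
      (Ad N (z ** g) $ i $ j - Ad N g $ i $ j) * Ad N D $ j $ j"
    by (simp add: algebra_simps)
  then have "(Ad N D $ i $ i - Ad N D $ j $ j) * Ad N g $ i $ j \<in> \<mm> (Suc k)"
    using cong by (simp add: max_ideal_pow_mult_right)
  then show ?thesis using unit by (simp add: max_ideal_pow_unit_mult_iff)
qed

lemma diagonal_if_conj_trivial_mod_frattini:
  assumes D: "diagonal (Ad N D)"
    and distinct: "\<And>i j. i \<noteq> j \<Longrightarrow> Ad N D $ i $ i - Ad N D $ j $ j dvd 1"
    and conj: "\<And>g. g \<in> \<Gamma> \<Longrightarrow> \<exists>z\<in>\<Phi>. D ** g = z ** g ** D"
    and "g \<in> \<Gamma>"
  shows "diagonal (Ad N g)"
  unfolding diagonal_def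
proof (intro allI impI)
  fix i j :: 2
  assume "i \<noteq> j"
  have "\<forall>g\<in>\<Gamma>. Ad N g $ i $ j \<in> \<mm> k" for k
  proof (induction k)
    case 0
    show ?case by simp
  next
    case (Suc k)
    then show ?case
      using Ad_entry_conj_frattini[OF \<open>i \<noteq> j\<close> _ D distinct[OF \<open>i \<noteq> j\<close>]] conj by metis
  qed
  then show "Ad N g $ i $ j = 0"
    using \<open>g \<in> \<Gamma>\<close> by (intro eq_0_if_mem_all_max_ideal_pow) blast
qed

end

lemma conj_eq_frattini_mult:
  assumes D: "invertible D" and g: "g \<in> \<Gamma>"
    and trivial: "\<And>C. C \<in> carrier (GL2\<lparr>carrier := \<Gamma>\<rparr> Mod \<Phi>) \<Longrightarrow> Ad D ` C = C"
  shows "\<exists>z\<in>\<Phi>. D ** g = z ** g ** D"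
proof -
  let ?C = "\<Phi> #>\<^bsub>GL2\<lparr>carrier := \<Gamma>\<rparr>\<^esub> g"
  have coset: "?C = (\<lambda>z. z ** g) ` \<Phi>" by (auto simp: r_coset_def)
  have "?C \<in> carrier (GL2\<lparr>carrier := \<Gamma>\<rparr> Mod \<Phi>)"
    using g by (auto simp: FactGroup_def RCOSETS_def)
  then have "Ad D ` ?C = ?C" by (rule trivial)
  moreover have "mat 1 \<in> \<Phi>"
    using one_in_frattini[OF Gamma.is_group, of \<Gamma>_topology p] Gamma.one_closed
    unfolding topspace_Gamma by simp
  then have "g \<in> ?C" unfolding coset by (rule rev_image_eqI) simp
  ultimately have "Ad D g \<in> ?C" by blast
  then show ?thesis unfolding coset using Ad_eq_iff[OF D] by blast
qed

end

section \<open>Representations induced from a subgroup of index two\<close>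

locale index_two_subgroup = normal H G for H and G :: "('g, 'x) monoid_scheme" +
  fixes \<sigma> :: 'g
  assumes index: "card (rcosets\<^bsub>G\<^esub> H) = 2" and sigma: "\<sigma> \<in> carrier G - H"
begin

lemma sigma_carrier [simp]: "\<sigma> \<in> carrier G"
  using sigma by simp

lemma conj_sigma_mem: "h \<in> H \<Longrightarrow> \<sigma> \<otimes>\<^bsub>G\<^esub> h \<otimes>\<^bsub>G\<^esub> inv\<^bsub>G\<^esub> \<sigma> \<in> H"
  using inv_op_closed2[of \<sigma> h] by simp

lemma mult_inv_sigma_mem:
  assumes g: "g \<in> carrier G" "g \<notin> H"
  shows "g \<otimes>\<^bsub>G\<^esub> inv\<^bsub>G\<^esub> \<sigma> \<in> H"
proof -
  let ?C = "rcosets\<^bsub>G\<^esub> H"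
  have cosets: "H \<in> ?C" "H #>\<^bsub>G\<^esub> \<sigma> \<in> ?C" "H #>\<^bsub>G\<^esub> g \<in> ?C"
    using g by (auto simp: subgroup_in_rcosets[OF group_axioms] rcosetsI subset)
  have "H \<noteq> H #>\<^bsub>G\<^esub> \<sigma>" "H \<noteq> H #>\<^bsub>G\<^esub> g"
    using rcos_self[OF _ subgroup_axioms] g sigma by blast+
  moreover have "finite ?C" using index by (intro card_ge_0_finite) simp
  ultimately have "?C = {H, H #>\<^bsub>G\<^esub> \<sigma>}"
    using index cosets by (intro card_subset_eq[symmetric]) auto
  then have "H #>\<^bsub>G\<^esub> g = H #>\<^bsub>G\<^esub> \<sigma>" using cosets \<open>H \<noteq> H #>\<^bsub>G\<^esub> g\<close> by auto
  then have "g \<in> H #>\<^bsub>G\<^esub> \<sigma>" using rcos_self[OF g(1) subgroup_axioms] by simp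
  then show ?thesis using rcos_module_imp[OF group_axioms sigma_carrier] by simp
qed

definition Ind_values :: "('g \<Rightarrow> 'r::zero) \<Rightarrow> 'r ^ 2" where
  "Ind_values f = vector [f \<one>\<^bsub>G\<^esub>, f \<sigma>]"

context
  fixes chi :: "'g \<Rightarrow> 'r::comm_ring_1"
  assumes chi: "chi \<in> hom (G\<lparr>carrier := H\<rparr>) (units_of type_ring)"
begin

lemma character_mult: "h \<in> H \<Longrightarrow> k \<in> H \<Longrightarrow> chi (h \<otimes>\<^bsub>G\<^esub> k) = chi h * chi k"
  using hom_mult[OF chi, of h k] by (simp add: units_of_mult)

lemma character_one: "chi \<one>\<^bsub>G\<^esub> = 1"
proof -
  interpret group_hom "G\<lparr>carrier := H\<rparr>" "units_of (type_ring :: 'r ring)" chi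
    using chi type_ring.units_group subgroup_is_group[OF group_axioms]
    by (simp add: group_hom_def group_hom_axioms_def)
  show ?thesis using hom_one by (simp add: units_of_one)
qed

lemma inj_on_Ind_values: "inj_on Ind_values (Ind G H chi)"
proof (rule inj_onI)
  fix f f' assume Ind: "f \<in> Ind G H chi" "f' \<in> Ind G H chi" and "Ind_values f = Ind_values f'"
  then have evaluation: "f \<one>\<^bsub>G\<^esub> = f' \<one>\<^bsub>G\<^esub>" "f \<sigma> = f' \<sigma>"
    by (simp_all add: Ind_values_def vec_eq_iff forall_2)
  have translate: "f (h \<otimes>\<^bsub>G\<^esub> g) = chi h * f g" "f' (h \<otimes>\<^bsub>G\<^esub> g) = chi h * f' g"
    if "h \<in> H" "g \<in> carrier G" for h g
    using Ind that by (simp_all add: Ind_def)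
  show "f = f'"
  proof (rule extensionalityI[of _ "carrier G"])
    fix g assume g: "g \<in> carrier G"
    show "f g = f' g"
    proof (cases "g \<in> H")
      case True
      then show ?thesis using translate[OF True one_closed] evaluation g by simp
    next
      case False
      then show ?thesis
        using translate[OF mult_inv_sigma_mem[OF g False] sigma_carrier] evaluation g
        by (simp add: m_assoc)
    qed
  qed (use Ind in \<open>simp_all add: Ind_def\<close>)
qed

lemma surj_on_Ind_values: "Ind_values ` Ind G H chi = UNIV"
proof (intro equalityI subset_UNIV subsetI)
  fix v :: "'r ^ 2"
  define f where "f = (\<lambda>g\<in>carrier G.
    if g \<in> H then chi g * v $ 1 else chi (g \<otimes>\<^bsub>G\<^esub> inv\<^bsub>G\<^esub> \<sigma>) * v $ 2)"
  have "f (h \<otimes>\<^bsub>G\<^esub> g) = chi h * f g" if h: "h \<in> H" and g: "g \<in> carrier G" for h g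
  proof (cases "g \<in> H")
    case True
    then show ?thesis using h by (simp add: f_def character_mult mult.assoc)
  next
    case False
    have "h \<otimes>\<^bsub>G\<^esub> g \<notin> H"
    proof
      assume "h \<otimes>\<^bsub>G\<^esub> g \<in> H"
      then have "inv\<^bsub>G\<^esub> h \<otimes>\<^bsub>G\<^esub> (h \<otimes>\<^bsub>G\<^esub> g) \<in> H" using h by simp
      then show False using False h g by (simp flip: m_assoc)
    qed
    then show ?thesis
      using False h g character_mult[OF h mult_inv_sigma_mem[OF g False]]
      by (simp add: f_def m_assoc)
  qed
  then have "f \<in> Ind G H chi" by (simp add: Ind_def f_def)
  moreover have "Ind_values f = v"
    using sigma by (simp add: Ind_values_def f_def vec_eq_iff forall_2 character_one)
  ultimately show "v \<in> Ind_values ` Ind G H chi" by blast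
qed

lemma bij_betw_Ind_values: "bij_betw Ind_values (Ind G H chi) UNIV"
  using inj_on_Ind_values surj_on_Ind_values by (rule bij_betw_imageI)

end

text \<open>
  The rows of \<open>P\<close> are the coordinates of the functionals \<open>f \<mapsto> f \<one>\<close> and \<open>f \<mapsto> f \<sigma>\<close> on the
  induced module.
\<close>

definition induced_frame :: "('g \<Rightarrow> 'r::comm_ring_1) \<Rightarrow> ('g \<Rightarrow> 'r ^ 2 ^ 2) \<Rightarrow> 'r ^ 2 ^ 2 \<Rightarrow> bool" where
  "induced_frame chi \<rho> P \<longleftrightarrow>
    invertible P \<and> P $ 2 = P $ 1 v* \<rho> \<sigma> \<and> (\<forall>h\<in>H. P $ 1 v* \<rho> h = chi h *s P $ 1)"

context
  fixes chi :: "'g \<Rightarrow> 'r::comm_ring_1" and \<rho> :: "'g \<Rightarrow> 'r ^ 2 ^ 2"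
  assumes \<rho>: "\<rho> \<in> hom G GL2"
begin

lemma representation_mult: "g \<in> carrier G \<Longrightarrow> k \<in> carrier G \<Longrightarrow> \<rho> (g \<otimes>\<^bsub>G\<^esub> k) = \<rho> g ** \<rho> k"
  using hom_mult[OF \<rho>] by simp

lemma Ad_induced_frame:
  assumes frame: "induced_frame chi \<rho> P" and h: "h \<in> H"
  shows "Ad P (\<rho> h) = (\<chi> i j. if i = j then if i = 1 then chi h
    else chi (\<sigma> \<otimes>\<^bsub>G\<^esub> h \<otimes>\<^bsub>G\<^esub> inv\<^bsub>G\<^esub> \<sigma>) else 0)"
proof (rule Ad_eq_diagonal_if_rows)
  let ?k = "\<sigma> \<otimes>\<^bsub>G\<^esub> h \<otimes>\<^bsub>G\<^esub> inv\<^bsub>G\<^esub> \<sigma>"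
  show "invertible P" using frame by (simp add: induced_frame_def)
  have "\<sigma> \<otimes>\<^bsub>G\<^esub> h = ?k \<otimes>\<^bsub>G\<^esub> \<sigma>" using h by (simp add: m_assoc)
  then have "\<rho> \<sigma> ** \<rho> h = \<rho> ?k ** \<rho> \<sigma>"
    using h conj_sigma_mem[OF h] by (simp flip: representation_mult)
  then have "P $ 2 v* \<rho> h = P $ 1 v* \<rho> ?k v* \<rho> \<sigma>"
    using frame by (simp add: induced_frame_def vector_matrix_mul_assoc)
  then have "P $ 2 v* \<rho> h = chi ?k *s P $ 2"
    using frame conj_sigma_mem[OF h] by (simp add: induced_frame_def smult_vector_matrix_mult)
  moreover have "P $ 1 v* \<rho> h = chi h *s P $ 1" using frame h by (simp add: induced_frame_def)
  ultimately show "P $ i v* \<rho> h = (if i = 1 then chi h else chi ?k) *s P $ i" for i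
    using exhaust_2[of i] by auto
qed

lemma induced_frame_commute:
  assumes frame: "induced_frame chi \<rho> P" and "h \<in> H" "k \<in> H"
  shows "\<rho> h ** \<rho> k = \<rho> k ** \<rho> h"
proof -
  have "diagonal (Ad P (\<rho> h))" "diagonal (Ad P (\<rho> k))"
    using assms by (simp_all add: Ad_induced_frame diagonal_def)
  then have "Ad P (\<rho> h) ** Ad P (\<rho> k) = Ad P (\<rho> k) ** Ad P (\<rho> h)" by (rule diagonal_commute)
  then show ?thesis using frame by (simp add: induced_frame_def Ad_commute_iff)
qed

lemma equivalent_to_Ind_if_induced_frame:
  assumes chi: "chi \<in> hom (G\<lparr>carrier := H\<rparr>) (units_of type_ring)"
    and frame: "induced_frame chi \<rho> P"
  shows "equivalent_to_Ind G H chi \<rho>"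
proof -
  have P: "invertible P" "P $ 2 = P $ 1 v* \<rho> \<sigma>" "\<And>h. h \<in> H \<Longrightarrow> P $ 1 v* \<rho> h = chi h *s P $ 1"
    using frame by (simp_all add: induced_frame_def)
  define \<phi> where "\<phi> v = (\<lambda>g\<in>carrier G. ((P ** \<rho> g) *v v) $ 1)" for v
  have "\<rho> \<one>\<^bsub>G\<^esub> = mat 1" using hom_one[OF \<rho> group_axioms group_GL2] by simp
  then have evaluation: "Ind_values (\<phi> v) = P *v v" for v
    using P(2) by (simp add: Ind_values_def \<phi>_def vec_eq_iff[of "vector _"] forall_2
        matrix_vector_mult_def matrix_mult_row)
  have "(P ** \<rho> (h \<otimes>\<^bsub>G\<^esub> g)) $ 1 = chi h *s (P ** \<rho> g) $ 1" if "h \<in> H" "g \<in> carrier G" for h g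
    using that P(3) by (simp add: matrix_mult_row representation_mult smult_vector_matrix_mult
        flip: vector_matrix_mul_assoc)
  then have Ind: "\<phi> v \<in> Ind G H chi" for v
    by (simp add: Ind_def \<phi>_def matrix_vector_mult_def sum_distrib_left mult.assoc)
  show ?thesis
    unfolding equivalent_to_Ind_def
  proof (intro exI[of _ \<phi>] conjI allI ballI)
    have "bij_betw (Ind_values \<circ> \<phi>) UNIV UNIV"
      using bij_matrix_vector_mult[OF P(1)] by (simp add: comp_def evaluation)
    then show "bij_betw \<phi> UNIV (Ind G H chi)"
      using bij_betw_comp_iff2[OF bij_betw_Ind_values[OF chi], of \<phi> UNIV] Ind by blast
    show "\<phi> (u + v) = (\<lambda>g\<in>carrier G. \<phi> u g + \<phi> v g)" for u v
      by (auto simp: \<phi>_def matrix_vector_right_distrib)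
    show "\<phi> (c *s v) = (\<lambda>g\<in>carrier G. c * \<phi> v g)" for c v
      by (auto simp: \<phi>_def matrix_vector_mult_def sum_distrib_left mult.left_commute)
    show "\<phi> (\<rho> g *v v) = Ind_act G g (\<phi> v)" if "g \<in> carrier G" for g v
      using that by (auto simp: \<phi>_def Ind_act_def representation_mult matrix_vector_mul_assoc
          matrix_mul_assoc)
  qed
qed

lemma induced_frame_if_equivalent_to_Ind:
  assumes chi: "chi \<in> hom (G\<lparr>carrier := H\<rparr>) (units_of type_ring)"
    and "equivalent_to_Ind G H chi \<rho>"
  obtains P where "induced_frame chi \<rho> P"
proof -
  obtain \<phi> where bij: "bij_betw \<phi> UNIV (Ind G H chi)"
    and add: "\<And>u v. \<phi> (u + v) = (\<lambda>g\<in>carrier G. \<phi> u g + \<phi> v g)"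
    and scale: "\<And>c v. \<phi> (c *s v) = (\<lambda>g\<in>carrier G. c * \<phi> v g)"
    and act: "\<And>k v. k \<in> carrier G \<Longrightarrow> \<phi> (\<rho> k *v v) = Ind_act G k (\<phi> v)"
    using assms(2) unfolding equivalent_to_Ind_def by blast
  define P :: "'r ^ 2 ^ 2" where "P = (\<chi> i j. Ind_values (\<phi> (axis j 1)) $ i)"
  have evaluation: "P *v v = Ind_values (\<phi> v)" for v
    unfolding P_def
    by (rule linear_eq_matrix_vector_mult[symmetric])
      (simp_all add: Ind_values_def vec_eq_iff forall_2 add scale)
  have "bij_betw (Ind_values \<circ> \<phi>) UNIV UNIV"
    using bij bij_betw_Ind_values[OF chi] by (rule bij_betw_trans)
  then have "invertible P" by (intro invertible_if_bij) (simp add: comp_def flip: evaluation)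
  moreover have "P $ 2 = P $ 1 v* \<rho> \<sigma>"
  proof -
    have "((P ** \<rho> \<sigma>) *v v) $ 1 = (P *v v) $ 2" for v
      by (simp add: evaluation act Ind_values_def Ind_act_def flip: matrix_vector_mul_assoc)
    from this[of "axis _ 1"] show ?thesis
      by (simp add: vec_eq_iff matrix_vector_mult_axis flip: matrix_mult_row)
  qed
  moreover have "P $ 1 v* \<rho> h = chi h *s P $ 1" if h: "h \<in> H" for h
  proof -
    have "\<phi> v \<in> Ind G H chi" for v using bij by (auto simp: bij_betw_def)
    then have "\<phi> v (h \<otimes>\<^bsub>G\<^esub> \<one>\<^bsub>G\<^esub>) = chi h * \<phi> v \<one>\<^bsub>G\<^esub>" for v
      using h one_closed unfolding Ind_def by blast
    then have "((P ** \<rho> h) *v v) $ 1 = chi h * (P *v v) $ 1" for v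
      using h by (simp add: evaluation act Ind_values_def Ind_act_def flip: matrix_vector_mul_assoc)
    from this[of "axis _ 1"] show ?thesis
      by (simp add: vec_eq_iff matrix_vector_mult_axis flip: matrix_mult_row)
  qed
  ultimately show thesis by (intro that[of P]) (simp add: induced_frame_def)
qed

end

end

section \<open>Lifts of residually induced representations\<close>

locale residually_induced = index_two_subgroup H G \<sigma> + complete_local_ring \<pi>
  for H and G :: "('g, 'x) monoid_scheme" and \<sigma> and \<pi> :: "'r::comm_ring_1 \<Rightarrow> 'f::field" +
  fixes p :: nat and T :: "'g topology" and chibar :: "'g \<Rightarrow> 'f"
    and \<rho>bar :: "'g \<Rightarrow> 'f ^ 2 ^ 2" and P :: "'f ^ 2 ^ 2"
    and \<rho> :: "'g \<Rightarrow> 'r ^ 2 ^ 2" and s :: "'f ^ 2 ^ 2 \<Rightarrow> 'r ^ 2 ^ 2"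
  assumes residue_char: "of_nat p = (0 :: 'f)"
    and chibar_ne_conj: "\<exists>h\<in>H. chibar h \<noteq> chibar (\<sigma> \<otimes>\<^bsub>G\<^esub> h \<otimes>\<^bsub>G\<^esub> inv\<^bsub>G\<^esub> \<sigma>)"
    and rhobar_hom: "\<rho>bar \<in> hom G GL2"
    and frame: "induced_frame chibar \<rho>bar P"
    and representation: "is_representation G T adic_topology \<rho>"
    and rho_lift: "g \<in> carrier G \<Longrightarrow> map_matrix \<pi> (\<rho> g) = \<rho>bar g"
    and s_hom: "s \<in> hom (GL2\<lparr>carrier := \<rho>bar ` H\<rparr>) (GL2\<lparr>carrier := \<rho> ` H\<rparr>)"
    and s_lift: "y \<in> \<rho>bar ` H \<Longrightarrow> map_matrix \<pi> (s y) = y"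
begin

abbreviation (input) \<Gamma> :: "('r ^ 2 ^ 2) set" where "\<Gamma> \<equiv> residual_kernel G \<pi> \<rho>bar \<rho>"
abbreviation (input) \<G> :: "('r ^ 2 ^ 2) topology" where "\<G> \<equiv> GL2_topology adic_topology"

lemma rho_hom: "\<rho> \<in> hom G GL2"
  using representation by (simp add: is_representation_def)

sublocale rho: group_hom G GL2 \<rho>
  by unfold_locales (rule rho_hom)

sublocale rhobar: group_hom G GL2 \<rho>bar
  by unfold_locales (rule rhobar_hom)

lemmas rho_mult = representation_mult[OF rho_hom]
  and rhobar_mult = representation_mult[OF rhobar_hom]

lemma invertible_rho: "g \<in> carrier G \<Longrightarrow> invertible (\<rho> g)"
  using rho.hom_closed by simp

lemma invertible_rhobar: "g \<in> carrier G \<Longrightarrow> invertible (\<rho>bar g)"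
  using rhobar.hom_closed by simp

lemma invertible_frame: "invertible P"
  using frame by (simp add: induced_frame_def)

lemma s_mem: "h \<in> H \<Longrightarrow> s (\<rho>bar h) \<in> \<rho> ` H"
  using s_hom by (auto simp: hom_def)

lemma invertible_s: "h \<in> H \<Longrightarrow> invertible (s (\<rho>bar h))"
  using s_mem[of h] invertible_rho by auto

lemma map_matrix_s: "h \<in> H \<Longrightarrow> map_matrix \<pi> (s (\<rho>bar h)) = \<rho>bar h"
  by (simp add: s_lift)

lemma s_commute:
  assumes "h \<in> H" "k \<in> H"
  shows "s (\<rho>bar h) ** s (\<rho>bar k) = s (\<rho>bar k) ** s (\<rho>bar h)"
proof -
  have "s (\<rho>bar h ** \<rho>bar k) = s (\<rho>bar h) ** s (\<rho>bar k)"
    "s (\<rho>bar k ** \<rho>bar h) = s (\<rho>bar k) ** s (\<rho>bar h)"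
    using assms hom_mult[OF s_hom] by simp_all
  then show ?thesis using induced_frame_commute[OF rhobar_hom frame assms] by simp
qed

lemma mem_residual_kernel_iff: "x \<in> \<Gamma> \<longleftrightarrow> (\<exists>g\<in>carrier G. x = \<rho> g \<and> \<rho>bar g = mat 1)"
  unfolding residual_kernel_def kernel_def using rho_lift by auto

lemma subgroup_residual_kernel: "subgroup \<Gamma> GL2"
proof -
  have "map_matrix \<pi> \<in> hom (GL2\<lparr>carrier := \<rho> ` carrier G\<rparr>) (GL2\<lparr>carrier := \<rho>bar ` carrier G\<rparr>)"
    by (auto simp: hom_def map_matrix_mult rho_lift)
  then interpret reduction: group_hom "GL2\<lparr>carrier := \<rho> ` carrier G\<rparr>"
      "GL2\<lparr>carrier := \<rho>bar ` carrier G\<rparr>" "map_matrix \<pi>"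
    by (intro group_hom.intro group_hom_axioms.intro GL2.subgroup_imp_group
        rho.img_is_subgroup rhobar.img_is_subgroup)
  show ?thesis
    unfolding residual_kernel_def
    by (rule GL2.incl_subgroup[OF rho.img_is_subgroup reduction.subgroup_kernel])
qed

sublocale residually_trivial_group \<pi> p \<Gamma>
proof (intro residually_trivial_group.intro residually_trivial_group_axioms.intro)
  show "complete_local_ring \<pi>" by (rule complete_local_ring_axioms)
  show "map_matrix \<pi> g = mat 1" if "g \<in> \<Gamma>" for g
    using that rho_lift by (auto simp: mem_residual_kernel_iff)
qed (rule residue_char subgroup_residual_kernel)+

lemma mem_subgroup_if_rhobar_trivial:
  assumes g: "g \<in> carrier G" "\<rho>bar g = mat 1"
  shows "g \<in> H"
proof (rule ccontr)
  assume "g \<notin> H"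
  define h where "h = g \<otimes>\<^bsub>G\<^esub> inv\<^bsub>G\<^esub> \<sigma>"
  have h: "h \<in> H" unfolding h_def by (rule mult_inv_sigma_mem[OF g(1) \<open>g \<notin> H\<close>])
  have "g = h \<otimes>\<^bsub>G\<^esub> \<sigma>" using g(1) by (simp add: h_def m_assoc)
  then have "\<rho>bar h ** \<rho>bar \<sigma> = mat 1"
    using g(2) h by (metis mem_carrier rhobar_mult sigma_carrier)
  then have "P $ 1 v* (\<rho>bar h ** \<rho>bar \<sigma>) = P $ 1" by simp
  then have "P $ 1 = chibar h *s P $ 2"
    using frame h
    by (simp add: induced_frame_def smult_vector_matrix_mult flip: vector_matrix_mul_assoc)
  then have "P $ 1 $ j = chibar h * P $ 2 $ j" for j by (metis vector_smult_component)
  then have "det P = 0" by (simp add: det_2)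
  then show False using invertible_frame by (simp add: invertible_det_nz)
qed

lemma residual_kernel_subset: "\<Gamma> \<subseteq> \<rho> ` H"
  using mem_subgroup_if_rhobar_trivial by (auto simp: mem_residual_kernel_iff)

lemma residual_kernel_splitting:
  assumes "h \<in> H"
  obtains x where "x \<in> \<Gamma>" "\<rho> h = x ** s (\<rho>bar h)"
proof -
  obtain k where k: "k \<in> H" "s (\<rho>bar h) = \<rho> k" using s_mem[OF assms] by blast
  then have "\<rho>bar k = \<rho>bar h" using map_matrix_s[OF assms] by (simp add: rho_lift)
  then have "\<rho>bar (h \<otimes>\<^bsub>G\<^esub> inv\<^bsub>G\<^esub> k) = mat 1"
    using assms k rhobar.hom_inv[of k] GL2.r_inv[of "\<rho>bar k"]
    by (simp add: rhobar_mult invertible_rhobar)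
  moreover have "h \<otimes>\<^bsub>G\<^esub> inv\<^bsub>G\<^esub> k \<in> carrier G" using assms k by simp
  ultimately have "\<rho> (h \<otimes>\<^bsub>G\<^esub> inv\<^bsub>G\<^esub> k) \<in> \<Gamma>" unfolding mem_residual_kernel_iff by blast
  moreover have "\<rho> h = \<rho> (h \<otimes>\<^bsub>G\<^esub> inv\<^bsub>G\<^esub> k) ** s (\<rho>bar h)"
    using rho_mult[of "h \<otimes>\<^bsub>G\<^esub> inv\<^bsub>G\<^esub> k" k] assms k by (simp add: m_assoc)
  ultimately show thesis by (rule that)
qed

lemma ad_act_eq_Ad:
  assumes "a \<in> ad_image H \<rho>bar"
  obtains h where "h \<in> H" "Ad (\<rho>bar h) = a" "ad_act H \<rho>bar s a = Ad (s (\<rho>bar h))"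
proof -
  define y where "y = (SOME y. y \<in> \<rho>bar ` H \<and> Ad y = a)"
  have "\<exists>y. y \<in> \<rho>bar ` H \<and> Ad y = a" using assms by (auto simp: ad_image_def)
  then have "y \<in> \<rho>bar ` H \<and> Ad y = a" unfolding y_def by (rule someI_ex)
  moreover have "ad_act H \<rho>bar s a = Ad (s y)"
    by (simp add: fun_eq_iff ad_act_def Ad_def Let_def y_def)
  ultimately show thesis using that by blast
qed

lemma diagonal_Ad_rhobar: "h \<in> H \<Longrightarrow> diagonal (Ad P (\<rho>bar h))"
  by (simp add: Ad_induced_frame[OF rhobar_hom frame] diagonal_def)

text \<open>
  Since \<open>ad_act\<close> chooses a preimage in \<open>\<rho>bar ` H\<close>, it has to be seen that distinctness of the
  two eigenvalues of \<open>\<rho>bar h\<close> depends only on \<open>Ad (\<rho>bar h)\<close>.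
\<close>

lemma regular_element:
  obtains a k where "a \<in> ad_image H \<rho>bar" "k \<in> H" "ad_act H \<rho>bar s a = Ad (s (\<rho>bar k))"
    "Ad P (\<rho>bar k) $ 1 $ 1 \<noteq> Ad P (\<rho>bar k) $ 2 $ 2"
proof -
  have trivial_iff: "(\<forall>A. Ad (\<rho>bar h) A = A) \<longleftrightarrow> Ad P (\<rho>bar h) $ 1 $ 1 = Ad P (\<rho>bar h) $ 2 $ 2"
    if "h \<in> H" for h
    using that
    by (intro Ad_trivial_iff invertible_rhobar invertible_frame diagonal_Ad_rhobar) simp_all
  obtain h where h: "h \<in> H" "chibar h \<noteq> chibar (\<sigma> \<otimes>\<^bsub>G\<^esub> h \<otimes>\<^bsub>G\<^esub> inv\<^bsub>G\<^esub> \<sigma>)"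
    using chibar_ne_conj by blast
  then have "Ad (\<rho>bar h) \<in> ad_image H \<rho>bar" by (auto simp: ad_image_def)
  then obtain k where k: "k \<in> H" "Ad (\<rho>bar k) = Ad (\<rho>bar h)"
    "ad_act H \<rho>bar s (Ad (\<rho>bar h)) = Ad (s (\<rho>bar k))"
    by (rule ad_act_eq_Ad)
  have "Ad P (\<rho>bar h) $ 1 $ 1 \<noteq> Ad P (\<rho>bar h) $ 2 $ 2"
    using h by (simp add: Ad_induced_frame[OF rhobar_hom frame])
  then have "Ad P (\<rho>bar k) $ 1 $ 1 \<noteq> Ad P (\<rho>bar k) $ 2 $ 2"
    using trivial_iff[OF h(1)] trivial_iff[OF k(1)] unfolding k(2) by blast
  then show thesis using that \<open>Ad (\<rho>bar h) \<in> ad_image H \<rho>bar\<close> k by blast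
qed

lemma dihedral_if_diagonal:
  assumes N: "invertible N" "map_matrix \<pi> N = P"
    and diagonal: "\<And>h. h \<in> H \<Longrightarrow> diagonal (Ad N (\<rho> h))"
  shows "dihedral G T H \<pi> chibar \<rho>"
proof -
  define chi where "chi h = Ad N (\<rho> h) $ 1 $ 1" for h
  have hom: "chi \<in> hom (G\<lparr>carrier := H\<rparr>) (units_of type_ring)"
    unfolding chi_def using N(1) diagonal rho_hom
    by (intro diagonal_entry_hom subgroup_imp_group subgroup_axioms) (auto simp: hom_def)
  have "continuous_map (subtopology T H) \<G> \<rho>"
    using representation by (simp add: is_representation_def continuous_map_from_subtopology)
  then have "continuous_map (subtopology T H) adic_topology chi"
    unfolding chi_def by (rule continuous_map_Ad_entry[OF N(1)])
  with hom have character: "is_character G T H adic_topology chi" by (simp add: is_character_def)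
  have lift: "\<pi> (chi h) = chibar h" if "h \<in> H" for h
  proof -
    have "\<pi> (chi h) = map_matrix \<pi> (Ad N (\<rho> h)) $ 1 $ 1" by (simp add: chi_def)
    also have "\<dots> = Ad P (\<rho>bar h) $ 1 $ 1" using that by (simp add: map_matrix_Ad N rho_lift)
    also have "\<dots> = chibar h" using that by (simp add: Ad_induced_frame[OF rhobar_hom frame])
    finally show ?thesis .
  qed
  define M :: "'r ^ 2 ^ 2" where "M = vector [N $ 1, N $ 1 v* \<rho> \<sigma>]"
  have "map_matrix \<pi> (N ** \<rho> \<sigma>) $ 1 = P $ 2"
    using frame by (simp add: map_matrix_mult N rho_lift matrix_mult_row induced_frame_def)
  then have "map_matrix \<pi> M = P"
    using N(2) by (auto simp: M_def vec_eq_iff forall_2 simp flip: matrix_mult_row)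
  then have "invertible M" using invertible_frame invertible_map_matrix_iff by metis
  then have "induced_frame chi \<rho> M"
    using row_if_diagonal_Ad[OF N(1) diagonal] by (simp add: induced_frame_def M_def chi_def)
  then have "equivalent_to_Ind G H chi \<rho>"
    by (rule equivalent_to_Ind_if_induced_frame[OF rho_hom hom])
  with character lift show ?thesis unfolding dihedral_def by blast
qed

lemma dihedral_if_trivial_mod_frattini:
  assumes trivial: "\<forall>a\<in>ad_image H \<rho>bar. \<forall>C\<in>carrier (GL2\<lparr>carrier := \<Gamma>\<rparr> Mod \<Phi>).
    ad_act H \<rho>bar s a ` C = C"
  shows "dihedral G T H \<pi> chibar \<rho>"
proof -
  obtain a k where k: "a \<in> ad_image H \<rho>bar" "k \<in> H" "ad_act H \<rho>bar s a = Ad (s (\<rho>bar k))"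
    "Ad P (\<rho>bar k) $ 1 $ 1 \<noteq> Ad P (\<rho>bar k) $ 2 $ 2"
    by (rule regular_element)
  define D where "D = s (\<rho>bar k)"
  have D: "map_matrix \<pi> D = \<rho>bar k" "invertible D"
    unfolding D_def using k(2) by (rule map_matrix_s invertible_s)+
  obtain N where N: "invertible N" "map_matrix \<pi> N = P" "diagonal (Ad N D)"
      and distinct: "\<And>i j. i \<noteq> j \<Longrightarrow> Ad N D $ i $ i - Ad N D $ j $ j dvd 1"
    using lift_diagonalization[OF invertible_frame, of D] diagonal_Ad_rhobar[OF k(2)] k(4)
    unfolding D by blast
  have conj: "\<exists>z\<in>\<Phi>. D ** g = z ** g ** D" if "g \<in> \<Gamma>" for g
    using D(2) that
  proof (rule conj_eq_frattini_mult)
    show "Ad D ` C = C" if "C \<in> carrier (GL2\<lparr>carrier := \<Gamma>\<rparr> Mod \<Phi>)" for C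
      using that trivial k(1) unfolding D_def k(3)[symmetric] by blast
  qed
  have "diagonal (Ad N (\<rho> h))" if h: "h \<in> H" for h
  proof -
    obtain x where x: "x \<in> \<Gamma>" "\<rho> h = x ** s (\<rho>bar h)" using residual_kernel_splitting[OF h] .
    have "diagonal (Ad N x)"
      using diagonal_if_conj_trivial_mod_frattini[OF N(1,3) distinct conj x(1)] .
    moreover have "diagonal (Ad N (s (\<rho>bar h)))"
      using diagonal_if_commute[OF N(3) distinct] s_commute[OF k(2) h]
      by (simp add: Ad_commute_iff[OF N(1)] D_def)
    ultimately show ?thesis by (simp add: x(2) Ad_mult[OF N(1)] diagonal_mult)
  qed
  then show ?thesis by (rule dihedral_if_diagonal[OF N(1,2)])
qed

lemma trivial_mod_frattini_if_trivial:
  assumes "\<forall>a\<in>ad_image H \<rho>bar. \<forall>x\<in>\<Gamma>. ad_act H \<rho>bar s a x = x"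
  shows "\<forall>a\<in>ad_image H \<rho>bar. \<forall>C\<in>carrier (GL2\<lparr>carrier := \<Gamma>\<rparr> Mod \<Phi>). ad_act H \<rho>bar s a ` C = C"
proof (intro ballI)
  fix a C assume a: "a \<in> ad_image H \<rho>bar" and "C \<in> carrier (GL2\<lparr>carrier := \<Gamma>\<rparr> Mod \<Phi>)"
  then have "C \<subseteq> \<Gamma>"
    using frattini_subset_Gamma Gamma.m_closed by (auto simp: FactGroup_def RCOSETS_def r_coset_def)
  then have "ad_act H \<rho>bar s a x = x" if "x \<in> C" for x using assms a that by blast
  then show "ad_act H \<rho>bar s a ` C = C" by force
qed

lemma rho_commute_if_dihedral:
  assumes "dihedral G T H \<pi> chibar \<rho>" "x \<in> \<rho> ` H" "y \<in> \<rho> ` H"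
  shows "x ** y = y ** x"
proof -
  obtain chi where "chi \<in> hom (G\<lparr>carrier := H\<rparr>) (units_of type_ring)" "equivalent_to_Ind G H chi \<rho>"
    using assms(1) by (auto simp: dihedral_def is_character_def)
  then obtain Q where "induced_frame chi \<rho> Q"
    by (rule induced_frame_if_equivalent_to_Ind[OF rho_hom])
  then show ?thesis using assms(2,3) induced_frame_commute[OF rho_hom] by blast
qed

lemma trivial_if_dihedral:
  assumes "dihedral G T H \<pi> chibar \<rho>"
  shows "\<forall>a\<in>ad_image H \<rho>bar. \<forall>x\<in>\<Gamma>. ad_act H \<rho>bar s a x = x"
proof (intro ballI)
  fix a x assume "a \<in> ad_image H \<rho>bar" and x: "x \<in> \<Gamma>"
  then obtain h where h: "h \<in> H" "ad_act H \<rho>bar s a = Ad (s (\<rho>bar h))" using ad_act_eq_Ad by metis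
  have "s (\<rho>bar h) ** x = x ** s (\<rho>bar h)"
    using rho_commute_if_dihedral[OF assms s_mem[OF h(1)]] x residual_kernel_subset by blast
  then show "ad_act H \<rho>bar s a x = x" by (simp add: h(2) Ad_eq_iff invertible_s[OF h(1)])
qed

lemma subgroup_rho_image: "subgroup (\<rho> ` H) GL2"
  by (rule rho.subgroup_img_is_subgroup[OF subgroup_axioms])

lemma continuous_map_s_residue:
  "continuous_map (subtopology \<G> (\<rho> ` H)) (subtopology \<G> (\<rho> ` H)) (\<lambda>x. s (map_matrix \<pi> x))"
proof (rule continuous_map_into_subtopology)
  have "continuous_map (subtopology \<G> (\<rho> ` H)) (subtopology (discrete_topology UNIV) (\<rho>bar ` H))
      (map_matrix \<pi>)"
    using rho_lift
    by (intro continuous_map_into_subtopology continuous_map_from_subtopology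
        continuous_map_residue) auto
  moreover have "continuous_map (discrete_topology (\<rho>bar ` H)) \<G> s"
    using invertible_s by auto
  ultimately show "continuous_map (subtopology \<G> (\<rho> ` H)) \<G> (\<lambda>x. s (map_matrix \<pi> x))"
    using continuous_map_compose[of _ _ "map_matrix \<pi>" \<G> s] by (simp add: comp_def)
  show "(\<lambda>x. s (map_matrix \<pi> x)) \<in> topspace (subtopology \<G> (\<rho> ` H)) \<rightarrow> \<rho> ` H"
    using s_mem by (auto simp: rho_lift)
qed

lemma kernel_s_residue:
  "kernel (GL2\<lparr>carrier := \<rho> ` H\<rparr>) (GL2\<lparr>carrier := \<rho> ` H\<rparr>) (\<lambda>x. s (map_matrix \<pi> x)) = \<Gamma>"
proof (intro equalityI subsetI)
  fix x assume "x \<in> kernel (GL2\<lparr>carrier := \<rho> ` H\<rparr>) (GL2\<lparr>carrier := \<rho> ` H\<rparr>) (\<lambda>x. s (map_matrix \<pi> x))"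
  then obtain h where h: "h \<in> H" "x = \<rho> h" "s (\<rho>bar h) = mat 1" by (auto simp: kernel_def rho_lift)
  then have "\<rho>bar h = mat 1" using map_matrix_s[OF h(1)] by simp
  then show "x \<in> \<Gamma>" using h(1,2) by (auto simp: mem_residual_kernel_iff intro!: bexI[of _ h])
next
  fix x assume x: "x \<in> \<Gamma>"
  have "group_hom (GL2\<lparr>carrier := \<rho>bar ` H\<rparr>) (GL2\<lparr>carrier := \<rho> ` H\<rparr>) s"
    by (intro group_hom.intro group_hom_axioms.intro GL2.subgroup_imp_group s_hom
        subgroup_rho_image rhobar.subgroup_img_is_subgroup subgroup_axioms)
  then have "s (mat 1) = mat 1" using group_hom.hom_one by fastforce
  then show "x \<in> kernel (GL2\<lparr>carrier := \<rho> ` H\<rparr>) (GL2\<lparr>carrier := \<rho> ` H\<rparr>) (\<lambda>x. s (map_matrix \<pi> x))"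
    using x residual_kernel_subset by (auto simp: kernel_def map_matrix_Gamma)
qed

lemma product_decomposition_if_dihedral:
  assumes "dihedral G T H \<pi> chibar \<rho>"
  shows "topologically_isomorphic
    (GL2\<lparr>carrier := \<Gamma>\<rparr> \<times>\<times> GL2\<lparr>carrier := s ` \<rho>bar ` H\<rparr>)
    (prod_topology (subtopology \<G> \<Gamma>) (subtopology \<G> (s ` \<rho>bar ` H)))
    (GL2\<lparr>carrier := \<rho> ` H\<rparr>) (subtopology \<G> (\<rho> ` H))"
proof -
  let ?K = "GL2\<lparr>carrier := \<rho> ` H\<rparr>" and ?r = "\<lambda>x. s (map_matrix \<pi> x)"
  have image: "?r ` \<rho> ` H = s ` \<rho>bar ` H" by (simp add: image_image rho_lift)
  have "topological_group_retraction ?K (subtopology \<G> (\<rho> ` H)) ?r"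
  proof (intro topological_group_retraction.intro topological_group_retraction_axioms.intro)
    show "group ?K" by (rule GL2.subgroup_imp_group[OF subgroup_rho_image])
    show "topological_group ?K (subtopology \<G> (\<rho> ` H))"
      by (rule topological_group_subgroup[OF topological_group_GL2 subgroup_rho_image])
    show "?r \<in> hom ?K ?K"
      using s_mem hom_mult[OF s_hom] by (auto simp: hom_def map_matrix_mult rho_lift)
    show "?r (?r x) = ?r x" if "x \<in> carrier ?K" for x
      using that map_matrix_s by (auto simp: rho_lift)
    show "x \<otimes>\<^bsub>?K\<^esub> ?r y = ?r y \<otimes>\<^bsub>?K\<^esub> x" if "x \<in> kernel ?K ?K ?r" "y \<in> carrier ?K" for x y
      using that s_mem residual_kernel_subset unfolding kernel_s_residue
      by (auto simp: rho_lift intro!: rho_commute_if_dihedral[OF assms])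
  qed (rule continuous_map_s_residue)
  from topological_group_retraction.topologically_isomorphic_kernel_image[OF this]
  have "topologically_isomorphic (GL2\<lparr>carrier := \<Gamma>\<rparr> \<times>\<times> GL2\<lparr>carrier := s ` \<rho>bar ` H\<rparr>)
    (prod_topology (subtopology (subtopology \<G> (\<rho> ` H)) \<Gamma>)
      (subtopology (subtopology \<G> (\<rho> ` H)) (s ` \<rho>bar ` H))) ?K (subtopology \<G> (\<rho> ` H))"
    by (simp add: kernel_s_residue image)
  moreover have "s ` \<rho>bar ` H \<subseteq> \<rho> ` H" using s_mem by auto
  ultimately show ?thesis
    using residual_kernel_subset by (simp add: subtopology_subtopology Int_absorb1)
qed

end

theorem theorem1p1:
  fixes p :: nat
    and G :: "('g, 'x) monoid_scheme" and T :: "'g topology"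
    and H :: "'g set" and \<sigma> :: 'g
    and chibar :: "'g \<Rightarrow> 'f::{field,finite}" and \<rho>bar :: "'g \<Rightarrow> 'f ^ 2 ^ 2"
    and \<alpha> :: "(nat \<Rightarrow> 'f) \<Rightarrow> 'r::comm_ring_1" and \<pi> :: "'r \<Rightarrow> 'f"
    and \<rho> :: "'g \<Rightarrow> 'r ^ 2 ^ 2" and s :: "'f ^ 2 ^ 2 \<Rightarrow> 'r ^ 2 ^ 2"
  assumes "Factorial_Ring.prime p" and "CHAR('f) = p"
    and "profinite_group G T"
    and "H \<lhd> G" and "openin T H" and "card (rcosets\<^bsub>G\<^esub> H) = 2"
    and "\<sigma> \<in> carrier G - H"
    and "is_character G T H (discrete_topology UNIV) chibar"
    and "\<exists>h\<in>H. chibar h \<noteq> chibar (\<sigma> \<otimes>\<^bsub>G\<^esub> h \<otimes>\<^bsub>G\<^esub> inv\<^bsub>G\<^esub> \<sigma>)"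
    and "\<rho>bar \<in> hom G GL2" and "equivalent_to_Ind G H chibar \<rho>bar"
    and "coefficient_algebra p \<alpha> \<pi>"
    and "is_representation G T adic_topology \<rho>"
    and "\<forall>g\<in>carrier G. map_matrix \<pi> (\<rho> g) = \<rho>bar g"
    and "s \<in> hom (GL2\<lparr>carrier := \<rho>bar ` H\<rparr>) (GL2\<lparr>carrier := \<rho> ` H\<rparr>)"
    and "\<forall>y\<in>\<rho>bar ` H. map_matrix \<pi> (s y) = y"
  defines "\<Gamma> \<equiv> residual_kernel G \<pi> \<rho>bar \<rho>"
    and "\<G> \<equiv> GL2_topology (adic_topology :: 'r topology)"
  defines "\<Phi> \<equiv> frattini p (GL2\<lparr>carrier := \<Gamma>\<rparr>) (subtopology \<G> \<Gamma>)"
  defines "trivial_on_\<Gamma> \<equiv> \<forall>a\<in>ad_image H \<rho>bar. \<forall>x\<in>\<Gamma>. ad_act H \<rho>bar s a x = x"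
    and "trivial_on_\<Gamma>_mod_\<Phi> \<equiv>
      \<forall>a\<in>ad_image H \<rho>bar. \<forall>C\<in>carrier (GL2\<lparr>carrier := \<Gamma>\<rparr> Mod \<Phi>). ad_act H \<rho>bar s a ` C = C"
  shows "(dihedral G T H \<pi> chibar \<rho> \<longleftrightarrow> trivial_on_\<Gamma>) \<and>
    (trivial_on_\<Gamma> \<longleftrightarrow> trivial_on_\<Gamma>_mod_\<Phi>) \<and>
    (trivial_on_\<Gamma> \<longrightarrow>
      topologically_isomorphic
        (GL2\<lparr>carrier := \<Gamma>\<rparr> \<times>\<times> GL2\<lparr>carrier := s ` \<rho>bar ` H\<rparr>)
        (prod_topology (subtopology \<G> \<Gamma>) (subtopology \<G> (s ` \<rho>bar ` H)))
        (GL2\<lparr>carrier := \<rho> ` H\<rparr>) (subtopology \<G> (\<rho> ` H)))"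
proof -
  have ring: "complete_local_ring \<pi>"
    using \<open>coefficient_algebra p \<alpha> \<pi>\<close>
    by (simp add: coefficient_algebra_def complete_local_ring_def)
  interpret index_two_subgroup H G \<sigma>
    using assms(4,6,7) by (intro index_two_subgroup.intro index_two_subgroup_axioms.intro)
  obtain P where P: "induced_frame chibar \<rho>bar P"
    using assms(8,10,11) induced_frame_if_equivalent_to_Ind unfolding is_character_def by blast
  interpret residually_induced H G \<sigma> \<pi> p T chibar \<rho>bar P \<rho> s
    using of_nat_CHAR[where 'a = 'f] assms(2,9,10,13-16) P
    by (intro residually_induced.intro residually_induced_axioms.intro
        index_two_subgroup_axioms ring) auto
  note defs = \<Gamma>_def \<G>_def \<Phi>_def trivial_on_\<Gamma>_def trivial_on_\<Gamma>_mod_\<Phi>_def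
  have "trivial_on_\<Gamma>" if "dihedral G T H \<pi> chibar \<rho>"
    unfolding defs by (rule trivial_if_dihedral[OF that])
  moreover have "trivial_on_\<Gamma>_mod_\<Phi>" if "trivial_on_\<Gamma>"
    unfolding defs by (rule trivial_mod_frattini_if_trivial[OF that[unfolded defs]])
  moreover have "dihedral G T H \<pi> chibar \<rho>" if "trivial_on_\<Gamma>_mod_\<Phi>"
    by (rule dihedral_if_trivial_mod_frattini[OF that[unfolded defs]])
  ultimately show ?thesis
    using product_decomposition_if_dihedral unfolding \<Gamma>_def \<G>_def by blast
qed

end
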